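(* Let $(F_4)^{\gamma}=\{\alpha\in F_4 \mid \gamma\alpha\gamma=\alpha\}$ and $(F_4)^{\gamma_H}=\{\alpha\in F_4\mid \gamma_H\alpha\gamma_H=\alpha\}$. Then $$(F_4)^{\gamma}\cap (F_4)^{\gamma_H}\;\cong\;\big((U(1)\times U(3))/\mathbf{Z}_2\big)\rtimes \mathcal{Z}_2,$$ where $\mathbf{Z}_2=\{(1,E),(-1,-E)\}$ ($E$ the identity matrix) and $\mathcal{Z}_2=\{1,\gamma_C\}$ is the group of order $2$ generated by $\gamma_C$, acting through complex conjugation $\gamma_C(a,B)=(\overline{a},\overline{B})$.
   Context: Let $\mathbf{H}$ be the quaternions with basis $1,e_1,e_2,e_3=e_1e_2$, $\mathbf{C}=\mathbf{R}\oplus\mathbf{R}e_1$, $\mathbf{H}=\mathbf{C}\oplus\mathbf{C}e_2$, and let $\mathfrak{C}=\mathbf{H}\oplus\mathbf{H}e_4$ be the division Cayley algebra with product $(m+ae_4)(n+be_4)=(mn-\overline{b}a)+(a\overline{n}+bm)e_4$. Let $\mathfrak{J}=\{X\in M(3,\mathfrak{C})\mid X^*=X\}$ be the exceptional Jordan algebra with product $X\circ Y=\frac12(XY+YX)$, and $F_4=\{\alpha\in\mathrm{Iso}_{\mathbf R}(\mathfrak{J})\mid \alpha(X\circ Y)=\alpha X\circ\alpha Y\}$. On $\mathfrak{C}$ define $\gamma(x+ye_4)=x-ye_4$ ($x,y\in\mathbf{H}$); on $\mathbf{H}$ put $\gamma_H(a+be_2)=a-be_2$, $\gamma_C(a+be_2)=\overline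 a+\overline b e_2$ ($a,b\in \mathbf{C}$), extended to $\mathfrak{C}$ by $\gamma_H(x+ye_4)=\gamma_Hx+(\gamma_Hy)e_4$, $\gamma_C(x+ye_4)=\gamma_Cx+(\gamma_Cy)e_4$. These are automorphisms of $\mathfrak{C}$ of order $2$, and they act on $\mathfrak{J}$ entrywise, giving involutive elements $\gamma,\gamma_H,\gamma_C\in F_4$. $U(1)$ and $U(3)$ are the usual unitary groups over $\mathbf{C}$. The action of $\mathcal{Z}_2$ on $U(1)\times U(3)$ induces the action on the quotient. *)

theory Defs
  imports "HOL-Analysis.Analysis" "HOL-Algebra.Coset" "HOL-Algebra.Bij"
begin

(* A pair (a, b) of complex numbers stands for the quaternion a + b e2, so that e1 = (\<i>, 0),
   e2 = (0, 1), e3 = (0, \<i>); the product uses e2 c = (cnj c) e2 for complex c and e2 e2 = -1.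
   A pair (m, a) of quaternions stands for the octonion m + a e4.
   The real vector space structure is that of the product types. *)

type_synonym quat = "complex \<times> complex"
type_synonym cayley = "quat \<times> quat"

definition qmult :: "quat \<Rightarrow> quat \<Rightarrow> quat" where
  "qmult x y = (case (x, y) of ((a, b), (c, d)) \<Rightarrow> (a * c - b * cnj d, a * d + b * cnj c))"

definition qcnj :: "quat \<Rightarrow> quat" where
  "qcnj x = (case x of (a, b) \<Rightarrow> (cnj a, - b))"

definition cmult :: "cayley \<Rightarrow> cayley \<Rightarrow> cayley" where
  "cmult x y = (case (x, y) of ((m, a), (n, b)) \<Rightarrow>
     (qmult m n - qmult (qcnj b) a, qmult a (qcnj n) + qmult b m))"

definition ccnj :: "cayley \<Rightarrow> cayley" where
  "ccnj x = (case x of (m, a) \<Rightarrow> (qcnj m, - a))"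

(* The library matrix product needs a semiring of entries; the octonions are not associative. *)
definition cmat_mult :: "cayley^3^3 \<Rightarrow> cayley^3^3 \<Rightarrow> cayley^3^3" where
  "cmat_mult X Y = (\<chi> i j. \<Sum>k\<in>UNIV. cmult (X $ i $ k) (Y $ k $ j))"

definition cmat_star :: "cayley^3^3 \<Rightarrow> cayley^3^3" where
  "cmat_star X = transpose (map_matrix ccnj X)"

definition jordan :: "(cayley^3^3) set" where
  "jordan = {X. cmat_star X = X}"

definition jmult :: "cayley^3^3 \<Rightarrow> cayley^3^3 \<Rightarrow> cayley^3^3" where
  "jmult X Y = (1/2 :: real) *\<^sub>R (cmat_mult X Y + cmat_mult Y X)"

(* Maps on the Jordan algebra are extensional functions on its carrier, composed as in BijGroup. *)
definition F4 :: "(cayley^3^3 \<Rightarrow> cayley^3^3) monoid" where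
  "F4 = (BijGroup jordan)\<lparr>carrier := {\<alpha> \<in> Bij jordan.
     (\<forall>X\<in>jordan. \<forall>Y\<in>jordan. \<alpha> (X + Y) = \<alpha> X + \<alpha> Y) \<and>
     (\<forall>r::real. \<forall>X\<in>jordan. \<alpha> (r *\<^sub>R X) = r *\<^sub>R \<alpha> X) \<and>
     (\<forall>X\<in>jordan. \<forall>Y\<in>jordan. \<alpha> (jmult X Y) = jmult (\<alpha> X) (\<alpha> Y))}\<rparr>"

definition gamma0 :: "cayley \<Rightarrow> cayley" where
  "gamma0 z = (case z of (x, y) \<Rightarrow> (x, - y))"

definition gammaH_quat :: "quat \<Rightarrow> quat" where
  "gammaH_quat x = (case x of (a, b) \<Rightarrow> (a, - b))"

definition gammaC_quat :: "quat \<Rightarrow> quat" where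
  "gammaC_quat x = (case x of (a, b) \<Rightarrow> (cnj a, cnj b))"

definition gamma :: "cayley^3^3 \<Rightarrow> cayley^3^3" where
  "gamma = restrict (map_matrix gamma0) jordan"

definition gammaH :: "cayley^3^3 \<Rightarrow> cayley^3^3" where
  "gammaH = restrict (map_matrix (map_prod gammaH_quat gammaH_quat)) jordan"

definition gammaC :: "cayley^3^3 \<Rightarrow> cayley^3^3" where
  "gammaC = restrict (map_matrix (map_prod gammaC_quat gammaC_quat)) jordan"

definition F4_fixed :: "(cayley^3^3 \<Rightarrow> cayley^3^3) \<Rightarrow> (cayley^3^3 \<Rightarrow> cayley^3^3) set" where
  "F4_fixed \<sigma> = {\<alpha> \<in> carrier F4. \<sigma> \<otimes>\<^bsub>F4\<^esub> \<alpha> \<otimes>\<^bsub>F4\<^esub> \<sigma> = \<alpha>}"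

definition U1 :: "complex monoid" where
  "U1 = \<lparr>carrier = {z. cnj z * z = 1}, mult = (*), one = 1\<rparr>"

definition U3 :: "(complex^3^3) monoid" where
  "U3 = \<lparr>carrier = {A. transpose (map_matrix cnj A) ** A = mat 1 \<and>
                       A ** transpose (map_matrix cnj A) = mat 1},
         mult = (**), one = mat 1\<rparr>"

definition U1U3_quot :: "(complex \<times> (complex^3^3)) set monoid" where
  "U1U3_quot = (U1 \<times>\<times> U3) Mod {(1, mat 1), (- 1, - mat 1)}"

definition Z2C :: "(cayley^3^3 \<Rightarrow> cayley^3^3) monoid" where
  "Z2C = F4\<lparr>carrier := {\<one>\<^bsub>F4\<^esub>, gammaC}\<rparr>"

definition Z2C_act ::
  "(cayley^3^3 \<Rightarrow> cayley^3^3) \<Rightarrow> complex \<times> (complex^3^3) \<Rightarrow> complex \<times> (complex^3^3)" where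
  "Z2C_act k p = (if k = gammaC then map_prod cnj (map_matrix cnj) p else p)"

(* Elements of the quotient are cosets, on which the action is by direct image. *)
definition Z2C_act_quot ::
  "(cayley^3^3 \<Rightarrow> cayley^3^3) \<Rightarrow> (complex \<times> (complex^3^3)) set \<Rightarrow> (complex \<times> (complex^3^3)) set" where
  "Z2C_act_quot k c = Z2C_act k ` c"

definition semidirect ::
  "('a, 'm) monoid_scheme \<Rightarrow> ('b, 'n) monoid_scheme \<Rightarrow> ('b \<Rightarrow> 'a \<Rightarrow> 'a) \<Rightarrow> ('a \<times> 'b) monoid" where
  "semidirect N K \<theta> =
     \<lparr>carrier = carrier N \<times> carrier K,
      mult = (\<lambda>(n, k) (n', k'). (n \<otimes>\<^bsub>N\<^esub> \<theta> k n', k \<otimes>\<^bsub>K\<^esub> k')),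
      one = (\<one>\<^bsub>N\<^esub>, \<one>\<^bsub>K\<^esub>)\<rparr>"

end

theory Submission
  imports Defs
begin

text \<open>
  Splitting octonions as \<open>\<complex> \<oplus> \<complex>\<^sup>3\<close>, an element of the Jordan algebra becomes a quadruple \<open>(A, B, C, D)\<close> of
  complex matrices, \<open>A\<close> Hermitian and \<open>B, C, D\<close> skew-symmetric, and the four components are the
  joint eigenspaces of \<open>\<gamma>\<close> and \<open>\<gamma>\<^sub>H\<close>. A unitary \<open>U\<close> and unit scalars \<open>s, t, r\<close> with
  \<open>s t r (det U)\<^sup>2 = 1\<close> act by automorphisms as \<open>U A U\<^sup>*\<close>, \<open>s U B U\<^sup>T\<close>, \<open>t U C U\<^sup>T\<close>, \<open>r U D U\<^sup>T\<close>;
  normalising \<open>s = 1\<close> gives the homomorphism from \<open>U(1) \<times> U(3)\<close>, while \<open>\<gamma>\<^sub>C\<close> conjugates all components.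

  Conversely, let \<open>\<alpha>\<close> commute with \<open>\<gamma>\<close> and \<open>\<gamma>\<^sub>H\<close>. It preserves the four components.
  The images of the diagonal idempotents are orthogonal projections of rank one, so after composing with some \<open>U\<close>
  they are fixed. Then \<open>\<alpha>\<close> preserves the three off-diagonal entries of \<open>A\<close>, and after a diagonal
  \<open>U\<close> acts on all of them by one and the same real algebra endomorphism of \<open>\<complex>\<close>, the identity or the
  conjugation; in the second case compose with \<open>\<gamma>\<^sub>C\<close>. Once \<open>\<alpha>\<close> fixes all Hermitian \<open>A\<close>, equivariance under
  \<open>B \<mapsto> A B + B A\<^sup>T\<close> forces it to be a scalar on each of the other components.
\<close>

section \<open>Complex coordinates on the Jordan algebra\<close>

abbreviation cj :: "complex^3^3 \<Rightarrow> complex^3^3" where "cj \<equiv> map_matrix cnj"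

abbreviation adj :: "complex^3^3 \<Rightarrow> complex^3^3" where "adj A \<equiv> transpose (cj A)"

definition smul :: "complex \<Rightarrow> complex^3^3 \<Rightarrow> complex^3^3" where
  "smul c A = (\<chi> i j. c * A $ i $ j)"

definition herm :: "(complex^3^3) set" where "herm = {A. adj A = A}"

definition skew :: "(complex^3^3) set" where "skew = {B. transpose B = - B}"

lemmas matrix3_simps = vec_eq_iff forall_3 matrix_matrix_mult_def sum_3 transpose_def smul_def mat_def

lemma transpose_nth: "transpose A $ i $ j = A $ j $ i"
  by (simp add: transpose_def)

lemma cj_mult [simp]: "cj (A ** B) = cj A ** cj B"
  by (simp add: matrix3_simps)

lemma cj_cj [simp]: "cj (cj A) = A"
  by (simp add: vec_eq_iff)

lemma cj_add [simp]: "cj (A + B) = cj A + cj B"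
  by (simp add: vec_eq_iff)

lemma cj_diff [simp]: "cj (A - B) = cj A - cj B"
  by (simp add: vec_eq_iff)

lemma cj_minus [simp]: "cj (- A) = - cj A"
  by (simp add: vec_eq_iff)

lemma cj_zero [simp]: "cj 0 = 0"
  by (simp add: vec_eq_iff)

lemma cj_scaleR [simp]: "cj (c *\<^sub>R A) = c *\<^sub>R cj A"
  by (simp add: vec_eq_iff)

lemma cj_mat_1 [simp]: "cj (mat 1) = mat 1"
  by (simp add: vec_eq_iff mat_def)

lemma cj_transpose: "cj (transpose A) = transpose (cj A)"
  by (simp add: vec_eq_iff transpose_def)

lemma cj_smul [simp]: "cj (smul c A) = smul (cnj c) (cj A)"
  by (simp add: vec_eq_iff smul_def)

lemma det_cj: "det (cj A) = cnj (det A)"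
  by (simp add: det_3)

lemma transpose_linear [simp]:
  fixes A B :: "complex^3^3"
  shows "transpose (A + B) = transpose A + transpose B" "transpose (A - B) = transpose A - transpose B"
    "transpose (- A) = - transpose A" "transpose (c *\<^sub>R A) = c *\<^sub>R transpose A"
    "transpose (smul z A) = smul z (transpose A)" "transpose (0 :: complex^3^3) = 0"
  by (simp_all add: vec_eq_iff transpose_def smul_def)

lemma matrix_mult_linear:
  fixes A B C :: "complex^3^3"
  shows "(A + B) ** C = A ** C + B ** C" "A ** (B + C) = A ** B + A ** C"
    "(A - B) ** C = A ** C - B ** C" "A ** (B - C) = A ** B - A ** C"
    "(- A) ** B = - (A ** B)" "A ** (- B) = - (A ** B)"
    "(c *\<^sub>R A) ** B = c *\<^sub>R (A ** B)" "A ** (c *\<^sub>R B) = c *\<^sub>R (A ** B)"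
    "0 ** A = 0" "A ** 0 = 0"
    "smul z A ** B = smul z (A ** B)" "A ** smul z B = smul z (A ** B)"
  by (simp_all add: matrix3_simps algebra_simps)

lemma smul_linear [simp]:
  "smul a (smul b A) = smul (a * b) A" "smul 1 A = A" "smul z 0 = 0"
  by (simp_all add: smul_def vec_eq_iff)

lemma smul_distrib:
  "smul z (A + B) = smul z A + smul z B" "smul z (A - B) = smul z A - smul z B"
  "smul z (- A) = - smul z A" "smul z (c *\<^sub>R A) = c *\<^sub>R smul z A"
  by (simp_all add: smul_def vec_eq_iff algebra_simps)

lemma det_smul: "det (smul c A) = c ^ 3 * det A"
  by (simp add: det_3 smul_def algebra_simps power3_eq_cube)

text \<open>Conjugating the last coordinate makes the product cyclically symmetric in \<open>B, C, D\<close>.\<close>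

definition oct :: "complex^3^3 \<Rightarrow> complex^3^3 \<Rightarrow> complex^3^3 \<Rightarrow> complex^3^3 \<Rightarrow> cayley^3^3" where
  "oct A B C D = (\<chi> i j. ((A $ i $ j, B $ i $ j), (C $ i $ j, cnj (D $ i $ j))))"

lemma oct_eq_iff [simp]: "oct A B C D = oct A' B' C' D' \<longleftrightarrow> A = A' \<and> B = B' \<and> C = C' \<and> D = D'"
  by (auto simp: oct_def vec_eq_iff)

lemma oct_cases: obtains A B C D where "X = oct A B C D"
proof
  show "X = oct (map_matrix (\<lambda>z. fst (fst z)) X) (map_matrix (\<lambda>z. snd (fst z)) X)
    (map_matrix (\<lambda>z. fst (snd z)) X) (map_matrix (\<lambda>z. cnj (snd (snd z))) X)"
    by (simp add: oct_def vec_eq_iff)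
qed

lemma oct_add: "oct A B C D + oct A' B' C' D' = oct (A + A') (B + B') (C + C') (D + D')"
  by (simp add: oct_def vec_eq_iff)

lemma oct_scaleR: "c *\<^sub>R oct A B C D = oct (c *\<^sub>R A) (c *\<^sub>R B) (c *\<^sub>R C) (c *\<^sub>R D)"
  by (simp add: oct_def vec_eq_iff)

text \<open>Octonion conjugation conjugates the first complex coordinate and negates the other
  three. Self-adjointness therefore makes the first matrix Hermitian and the other three
  skew-symmetric.\<close>

lemma oct_in_jordan_iff: "oct A B C D \<in> jordan \<longleftrightarrow> A \<in> herm \<and> B \<in> skew \<and> C \<in> skew \<and> D \<in> skew"
proof -
  have "cmat_star (oct A B C D) = oct (adj A) (- transpose B) (- transpose C) (- transpose D)"
    by (simp add: oct_def cmat_star_def vec_eq_iff ccnj_def qcnj_def transpose_def)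
  then show ?thesis
    by (auto simp: jordan_def herm_def skew_def minus_equation_iff)
qed

text \<open>An octonion is a complex scalar plus a vector in complex 3-space. The product of two
  vector parts contributes minus their Hermitian pairing to the scalar and the conjugate of their
  cross product to the vector.\<close>

lemma cmat_mult_oct:
  "cmat_mult (oct A B C D) (oct A' B' C' D') =
     oct (A ** A' - B ** cj B' - C ** cj C' - D ** cj D')
         (A ** B' + B ** cj A' + (cj C ** cj D' - cj D ** cj C'))
         (A ** C' + C ** cj A' + (cj D ** cj B' - cj B ** cj D'))
         (A ** D' + D ** cj A' + (cj B ** cj C' - cj C ** cj B'))"
  by (simp add: cmat_mult_def oct_def vec_eq_iff matrix_matrix_mult_def sum_3
      cmult_def qmult_def qcnj_def algebra_simps)

lemma jmult_oct:
  "jmult (oct A B C D) (oct A' B' C' D') =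
     (1/2) *\<^sub>R oct (A ** A' + A' ** A - (B ** cj B' + B' ** cj B)
          - (C ** cj C' + C' ** cj C) - (D ** cj D' + D' ** cj D))
         (A ** B' + B' ** cj A + (A' ** B + B ** cj A')
          + (cj (C ** D' - D' ** C) + cj (C' ** D - D ** C')))
         (A ** C' + C' ** cj A + (A' ** C + C ** cj A')
          + (cj (D ** B' - B' ** D) + cj (D' ** B - B ** D')))
         (A ** D' + D' ** cj A + (A' ** D + D ** cj A')
          + (cj (B ** C' - C' ** B) + cj (B' ** C - C ** B')))"
  by (simp add: jmult_def cmat_mult_oct oct_add algebra_simps)

lemma jordan_cases:
  assumes "X \<in> jordan"
  obtains A B C D where "X = oct A B C D" "A \<in> herm" "B \<in> skew" "C \<in> skew" "D \<in> skew"
  using assms by (metis oct_cases oct_in_jordan_iff)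

lemma herm_entries:
  assumes "A \<in> herm"
  shows "A $ i $ j = cnj (A $ j $ i)"
proof -
  have "adj A $ i $ j = A $ i $ j" using assms by (simp add: herm_def)
  then show ?thesis by (simp only: transpose_nth nth_map_matrix)
qed

lemma skew_entries:
  assumes "B \<in> skew"
  shows "B $ i $ j = - B $ j $ i"
proof -
  have "transpose B $ i $ j = (- B) $ i $ j" using assms by (simp add: skew_def)
  then show ?thesis by (simp only: transpose_nth vector_uminus_component minus_minus minus_equation_iff[of "B $ i $ j"])
qed

lemma skew_expand:
  assumes "B \<in> skew"
  shows "B $ 1 $ 1 = 0" "B $ 2 $ 2 = 0" "B $ 3 $ 3 = 0"
    "B $ 2 $ 1 = - B $ 1 $ 2" "B $ 3 $ 1 = - B $ 1 $ 3" "B $ 3 $ 2 = - B $ 2 $ 3"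
  using skew_entries[OF assms, of 1 1] skew_entries[OF assms, of 2 2] skew_entries[OF assms, of 3 3]
    skew_entries[OF assms, of 2 1] skew_entries[OF assms, of 3 1] skew_entries[OF assms, of 3 2]
  by auto

lemma skew_eqI:
  assumes "B \<in> skew" "C \<in> skew" "B $ 1 $ 2 = C $ 1 $ 2" "B $ 1 $ 3 = C $ 1 $ 3" "B $ 2 $ 3 = C $ 2 $ 3"
  shows "B = C"
  using assms(3-) by (simp add: vec_eq_iff forall_3 skew_expand[OF assms(1)] skew_expand[OF assms(2)])

lemma skew_closed:
  "B \<in> skew \<Longrightarrow> C \<in> skew \<Longrightarrow> B + C \<in> skew" "B \<in> skew \<Longrightarrow> C \<in> skew \<Longrightarrow> B - C \<in> skew"
  "B \<in> skew \<Longrightarrow> - B \<in> skew" "B \<in> skew \<Longrightarrow> c *\<^sub>R B \<in> skew" "B \<in> skew \<Longrightarrow> smul z B \<in> skew"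
  "B \<in> skew \<Longrightarrow> cj B \<in> skew" "0 \<in> skew"
  by (simp_all add: skew_def smul_distrib flip: cj_transpose)

lemma skew_congruence:
  assumes "B \<in> skew"
  shows "U ** B ** transpose U \<in> skew"
  using assms by (simp add: skew_def matrix_transpose_mul matrix_mul_assoc[symmetric] matrix_mult_linear)

lemma skew_twisted_commutator:
  assumes "B \<in> skew" "C \<in> skew" "transpose E = E"
  shows "B ** E ** C - C ** E ** B \<in> skew"
  using assms by (simp add: skew_def matrix_transpose_mul matrix_mul_assoc[symmetric] matrix_mult_linear)

text \<open>Identifying skew matrices with vectors, the commutator is the cross product \<open>c \<times> d\<close>, the inner
  bracket is \<open>E (c \<times> d)\<close>, and the congruence by \<open>E\<close> acts as the adjugate of \<open>E\<close>.\<close>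

lemma symmetric_conjugated_commutator:
  assumes E: "transpose E = E" and C: "C \<in> skew" and D: "D \<in> skew"
  shows "E ** (C ** E ** D - D ** E ** C) ** E = smul (det E) (C ** D - D ** C)"
proof -
  have "E $ i $ j = E $ j $ i" for i j
    using E by (metis transpose_nth)
  then have sym: "E $ 2 $ 1 = E $ 1 $ 2" "E $ 3 $ 1 = E $ 1 $ 3" "E $ 3 $ 2 = E $ 2 $ 3"
    by blast+
  define W where "W = C ** D - D ** C"
  define K where "K = C ** E ** D - D ** E ** C"
  have W: "W \<in> skew"
    using skew_twisted_commutator[OF C D, of "mat 1"] by (simp add: W_def)
  have K: "K \<in> skew"
    using skew_twisted_commutator[OF C D E] by (simp add: K_def)
  \<comment> \<open>The entries of \<open>K\<close> are expressed through those of \<open>W\<close>,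
    so that \<open>C\<close> and \<open>D\<close> no longer occur when the upper entries of the two
    sides are compared.\<close>
  have K12: "K $ 1 $ 2 = E $ 1 $ 3 * W $ 2 $ 3 - E $ 2 $ 3 * W $ 1 $ 3 + E $ 3 $ 3 * W $ 1 $ 2"
    and K13: "K $ 1 $ 3 = - E $ 1 $ 2 * W $ 2 $ 3 + E $ 2 $ 2 * W $ 1 $ 3 - E $ 2 $ 3 * W $ 1 $ 2"
    and K23: "K $ 2 $ 3 = E $ 1 $ 1 * W $ 2 $ 3 - E $ 1 $ 2 * W $ 1 $ 3 + E $ 1 $ 3 * W $ 1 $ 2"
    unfolding K_def W_def
    by (simp_all add: matrix_matrix_mult_def sum_3 skew_expand[OF C] skew_expand[OF D] sym algebra_simps)
  have S: "E ** K ** E \<in> skew"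
    using skew_congruence[OF K, of E] by (simp add: E)
  have "E ** K ** E = smul (det E) W"
    by (rule skew_eqI[OF S skew_closed(5)[OF W]];
        simp add: matrix_matrix_mult_def sum_3 det_3 smul_def skew_expand[OF K] K12 K13 K23 sym algebra_simps)
  then show ?thesis
    by (simp add: K_def W_def)
qed

section \<open>Automorphisms given by unitary matrices\<close>

lemma U3_iff: "U \<in> carrier U3 \<longleftrightarrow> adj U ** U = mat 1"
  using matrix_left_right_inverse[of "adj U" U] by (simp add: U3_def)

lemma U3_cancel:
  assumes "U \<in> carrier U3"
  shows "adj U ** U = mat 1" "adj U ** (U ** X) = X" "U ** adj U = mat 1" "U ** (adj U ** X) = X"
    "transpose U ** cj U = mat 1" "transpose U ** (cj U ** X) = X"
    "cj U ** transpose U = mat 1" "cj U ** (transpose U ** X) = X"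
proof -
  show a: "adj U ** U = mat 1" and b: "U ** adj U = mat 1"
    using assms by (simp_all add: U3_def)
  show c: "transpose U ** cj U = mat 1" "cj U ** transpose U = mat 1"
    using arg_cong[OF a, of cj] arg_cong[OF b, of cj] by (simp_all add: cj_transpose)
  show "adj U ** (U ** X) = X" "U ** (adj U ** X) = X"
    "transpose U ** (cj U ** X) = X" "cj U ** (transpose U ** X) = X"
    by (simp_all only: matrix_mul_assoc a b c matrix_mul_lid)
qed

lemma U3_closed:
  "mat 1 \<in> carrier U3" "U \<in> carrier U3 \<Longrightarrow> V \<in> carrier U3 \<Longrightarrow> U ** V \<in> carrier U3"
  "U \<in> carrier U3 \<Longrightarrow> adj U \<in> carrier U3" "U \<in> carrier U3 \<Longrightarrow> cj U \<in> carrier U3"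
     apply (simp add: U3_iff)
    apply (simp add: U3_iff matrix_transpose_mul matrix_mul_assoc[symmetric] U3_cancel)
   apply (simp add: U3_iff cj_transpose U3_cancel)
  apply (simp add: U3_iff U3_cancel)
  done

lemma U3_det: "U \<in> carrier U3 \<Longrightarrow> cnj (det U) * det U = 1"
  using arg_cong[OF U3_cancel(1), of U det] by (simp add: det_mul det_cj)

text \<open>The relation between the scalars and \<open>det U\<close> is what makes the action
  compatible with the commutators of skew components.\<close>

definition admissible :: "complex^3^3 \<Rightarrow> complex \<Rightarrow> complex \<Rightarrow> complex \<Rightarrow> bool" where
  "admissible U s t r \<longleftrightarrow> U \<in> carrier U3 \<and> cnj s * s = 1 \<and> cnj t * t = 1 \<and> cnj r * r = 1 \<and>
     s * t * r * (det U)\<^sup>2 = 1"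

text \<open>The parameters are arbitrary, so closure and the composition law hold without
  admissibility; only the product law and bijectivity use it.\<close>

definition twist :: "complex^3^3 \<Rightarrow> complex \<Rightarrow> complex \<Rightarrow> complex \<Rightarrow> cayley^3^3 \<Rightarrow> cayley^3^3" where
  "twist U s t r = (\<lambda>X\<in>jordan.
     oct (U ** map_matrix (\<lambda>z. fst (fst z)) X ** adj U)
         (smul s (U ** map_matrix (\<lambda>z. snd (fst z)) X ** transpose U))
         (smul t (U ** map_matrix (\<lambda>z. fst (snd z)) X ** transpose U))
         (smul r (U ** map_matrix (\<lambda>z. cnj (snd (snd z))) X ** transpose U)))"

lemma twist_oct:
  assumes "A \<in> herm" "B \<in> skew" "C \<in> skew" "D \<in> skew"
  shows "twist U s t r (oct A B C D) = oct (U ** A ** adj U) (smul s (U ** B ** transpose U))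
     (smul t (U ** C ** transpose U)) (smul r (U ** D ** transpose U))"
proof -
  have "map_matrix (\<lambda>z. fst (fst z)) (oct A B C D) = A" "map_matrix (\<lambda>z. snd (fst z)) (oct A B C D) = B"
    "map_matrix (\<lambda>z. fst (snd z)) (oct A B C D) = C" "map_matrix (\<lambda>z. cnj (snd (snd z))) (oct A B C D) = D"
    by (simp_all add: oct_def vec_eq_iff)
  then show ?thesis
    using assms by (simp add: twist_def oct_in_jordan_iff)
qed

lemma herm_congruence:
  assumes "A \<in> herm"
  shows "U ** A ** adj U \<in> herm"
  using assms by (simp add: herm_def matrix_transpose_mul matrix_mul_assoc[symmetric] cj_transpose)

lemma herm_closed:
  "A \<in> herm \<Longrightarrow> B \<in> herm \<Longrightarrow> A + B \<in> herm" "A \<in> herm \<Longrightarrow> B \<in> herm \<Longrightarrow> A - B \<in> herm" "A \<in> herm \<Longrightarrow> c *\<^sub>R A \<in> herm" "A \<in> herm \<Longrightarrow> cj A \<in> herm"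
  "0 \<in> herm" "mat 1 \<in> herm"
  by (simp_all add: herm_def matrix_transpose_mul flip: cj_transpose)

text \<open>Put \<open>E = transpose U ** U\<close>, a symmetric matrix of determinant
  \<open>(det U)\<^sup>2\<close> that appears between the factors on the right. Unitarity rewrites
  the outer factors as \<open>cj U ** E\<close> and \<open>E ** adj U\<close>, and the conjugated
  commutator identity for \<open>E\<close> replaces all occurrences of \<open>E\<close> by the
  scalar \<open>det E\<close>.\<close>

lemma twist_bracket:
  assumes U: "U \<in> carrier U3" and u: "cnj s * s = 1" and str: "s * t * r * (det U)\<^sup>2 = 1"
    and C: "C \<in> skew" and D: "D \<in> skew"
  shows "smul s (U ** cj (C ** D - D ** C) ** transpose U) =
     cj (smul t (U ** C ** transpose U) ** smul r (U ** D ** transpose U)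
       - smul r (U ** D ** transpose U) ** smul t (U ** C ** transpose U))"
proof -
  define E where "E = transpose U ** U"
  have E: "transpose E = E" by (simp add: E_def matrix_transpose_mul)
  have dE: "det E = (det U)\<^sup>2" by (simp add: E_def det_mul power2_eq_square)
  \<comment> \<open>As \<open>s\<close> is a unit, its conjugate is its inverse, and the determinant
    relation evaluates that inverse.\<close>
  have "cnj s = cnj s * (s * t * r * (det U)\<^sup>2)" using str by simp
  also have "\<dots> = t * r * (det U)\<^sup>2" using u by (metis (no_types, lifting) mult.assoc mult_1)
  finally have s: "cnj s = t * r * (det U)\<^sup>2" .
  have "U ** (C ** E ** D - D ** E ** C) ** transpose U
     = cj U ** (E ** (C ** E ** D - D ** E ** C) ** E) ** adj U"
    by (simp add: E_def matrix_mul_assoc[symmetric] U3_cancel[OF U])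
  also have "\<dots> = smul (det E) (cj U ** (C ** D - D ** C) ** adj U)"
    by (subst symmetric_conjugated_commutator[OF E C D]) (simp only: matrix_mult_linear)
  finally have "smul (t * r) (U ** (C ** E ** D - D ** E ** C) ** transpose U)
     = smul (cnj s) (cj U ** (C ** D - D ** C) ** adj U)"
    by (simp add: s dE)
  then have "cj (smul (cnj s) (cj U ** (C ** D - D ** C) ** adj U)) =
     cj (smul (t * r) (U ** (C ** E ** D - D ** E ** C) ** transpose U))"
    by simp
  then show ?thesis
    by (simp add: E_def matrix_mult_linear matrix_mul_assoc smul_distrib cj_transpose mult.commute[of r t])
qed

text \<open>Admissibility is symmetric in the three scalars, so one bracket computation serves all
  three skew components.\<close>

lemma admissible_bracket:
  assumes "admissible U s t r" "C \<in> skew" "D \<in> skew"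
  shows "smul s (U ** cj (C ** D - D ** C) ** transpose U) =
     cj (smul t (U ** C ** transpose U) ** smul r (U ** D ** transpose U)
       - smul r (U ** D ** transpose U) ** smul t (U ** C ** transpose U))"
    "smul t (U ** cj (C ** D - D ** C) ** transpose U) =
     cj (smul r (U ** C ** transpose U) ** smul s (U ** D ** transpose U)
       - smul s (U ** D ** transpose U) ** smul r (U ** C ** transpose U))"
    "smul r (U ** cj (C ** D - D ** C) ** transpose U) =
     cj (smul s (U ** C ** transpose U) ** smul t (U ** D ** transpose U)
       - smul t (U ** D ** transpose U) ** smul s (U ** C ** transpose U))"
  by (rule twist_bracket; use assms in \<open>simp add: admissible_def mult_ac\<close>)+

lemma herm_product:
  assumes "U \<in> carrier U3"
  shows "(U ** A ** adj U) ** (U ** A' ** adj U) = U ** (A ** A') ** adj U"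
  by (simp add: matrix_mul_assoc[symmetric] U3_cancel[OF assms])

lemma skew_product:
  assumes "U \<in> carrier U3" "cnj s * s = 1"
  shows "smul s (U ** B ** transpose U) ** cj (smul s (U ** B' ** transpose U)) = U ** (B ** cj B') ** adj U"
  using assms(2)
  by (simp add: matrix_mult_linear matrix_mul_assoc[symmetric] U3_cancel[OF assms(1)] cj_transpose mult.commute)

lemma mixed_product:
  assumes "U \<in> carrier U3"
  shows "(U ** A ** adj U) ** smul s (U ** B ** transpose U) = smul s (U ** (A ** B) ** transpose U)"
    "smul s (U ** B ** transpose U) ** cj (U ** A ** adj U) = smul s (U ** (B ** cj A) ** transpose U)"
  by (simp_all add: matrix_mult_linear matrix_mul_assoc[symmetric] U3_cancel[OF assms] cj_transpose)

lemma herm_transpose: "A \<in> herm \<Longrightarrow> transpose A = cj A" "A \<in> herm \<Longrightarrow> transpose (cj A) = A"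
  by (metis (mono_tags) cj_cj cj_transpose herm_def mem_Collect_eq)+

lemma bracket_closed:
  "A \<in> herm \<Longrightarrow> A' \<in> herm \<Longrightarrow> A ** A' + A' ** A \<in> herm"
  "B \<in> skew \<Longrightarrow> B' \<in> skew \<Longrightarrow> B ** cj B' + B' ** cj B \<in> herm"
  "A \<in> herm \<Longrightarrow> B \<in> skew \<Longrightarrow> A ** B + B ** cj A \<in> skew"
  "B \<in> skew \<Longrightarrow> B' \<in> skew \<Longrightarrow> B ** B' - B' ** B \<in> skew"
     apply (simp add: herm_def matrix_transpose_mul)
    apply (simp add: herm_def skew_def matrix_transpose_mul matrix_mult_linear flip: cj_transpose)
   apply (simp add: skew_def matrix_transpose_mul matrix_mult_linear herm_transpose)
  apply (simp add: skew_def matrix_transpose_mul matrix_mult_linear)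
  done

lemma jmult_closed: "X \<in> jordan \<Longrightarrow> Y \<in> jordan \<Longrightarrow> jmult X Y \<in> jordan"
  by (elim jordan_cases)
    (simp add: jmult_oct oct_scaleR oct_in_jordan_iff herm_closed skew_closed bracket_closed
      del: cj_diff cj_mult)

lemma twist_jmult:
  assumes ad: "admissible U s t r" and X: "X \<in> jordan" and Y: "Y \<in> jordan"
  shows "twist U s t r (jmult X Y) = jmult (twist U s t r X) (twist U s t r Y)"
proof -
  from X obtain A B C D where X: "X = oct A B C D" and m: "A \<in> herm" "B \<in> skew" "C \<in> skew" "D \<in> skew"
    by (rule jordan_cases)
  from Y obtain A' B' C' D' where Y: "Y = oct A' B' C' D'"
    and m': "A' \<in> herm" "B' \<in> skew" "C' \<in> skew" "D' \<in> skew"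
    by (rule jordan_cases)
  have U: "U \<in> carrier U3" and u: "cnj s * s = 1" "cnj t * t = 1" "cnj r * r = 1"
    using ad by (auto simp: admissible_def)
  show ?thesis
    \<comment> \<open>\<open>twist_oct\<close> applies only to one Hermitian and three skew
      components; membership of the product in \<open>jordan\<close> supplies these
      conditions.\<close>
    using jmult_closed[OF assms(2,3)] unfolding X Y jmult_oct oct_scaleR oct_in_jordan_iff
    apply (subst twist_oct, blast, blast, blast, blast)
    apply (simp only: twist_oct m m' jmult_oct oct_scaleR herm_product[OF U] skew_product[OF U u(1)]
      skew_product[OF U u(2)] skew_product[OF U u(3)] mixed_product[OF U]
      admissible_bracket(1)[OF ad m(3) m'(4), symmetric] admissible_bracket(1)[OF ad m'(3) m(4), symmetric]
      admissible_bracket(2)[OF ad m(4) m'(2), symmetric] admissible_bracket(2)[OF ad m'(4) m(2), symmetric]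
      admissible_bracket(3)[OF ad m(2) m'(3), symmetric] admissible_bracket(3)[OF ad m'(2) m(3), symmetric])
    apply (simp add: matrix_mult_linear smul_distrib del: cj_diff)
    done
qed

section \<open>The centralizer\<close>

lemma F4_mult:
  assumes "\<alpha> \<in> Bij jordan" "\<beta> \<in> Bij jordan"
  shows "\<alpha> \<otimes>\<^bsub>F4\<^esub> \<beta> = compose jordan \<alpha> \<beta>"
  using assms by (simp add: F4_def BijGroup_def)

lemma Bij_mem: "\<alpha> \<in> Bij jordan \<Longrightarrow> X \<in> jordan \<Longrightarrow> \<alpha> X \<in> jordan"
  using Bij_imp_funcset by blast

lemma Bij_eqI:
  assumes "\<alpha> \<in> Bij jordan" "\<beta> \<in> Bij jordan" "\<And>X. X \<in> jordan \<Longrightarrow> \<alpha> X = \<beta> X"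
  shows "\<alpha> = \<beta>"
  using assms by (metis Bij_imp_extensional extensionalityI)

lemma involution_Bij:
  assumes "\<sigma> \<in> extensional jordan" "\<And>X. X \<in> jordan \<Longrightarrow> \<sigma> X \<in> jordan" "\<And>X. X \<in> jordan \<Longrightarrow> \<sigma> (\<sigma> X) = X"
  shows "\<sigma> \<in> Bij jordan"
proof -
  have "bij_betw \<sigma> jordan jordan"
    by (rule bij_betw_byWitness[where f' = \<sigma>]) (use assms(2,3) in auto)
  then show ?thesis using assms(1) by (simp add: Bij_def)
qed

lemma gamma_oct:
  assumes "A \<in> herm" "B \<in> skew" "C \<in> skew" "D \<in> skew"
  shows "gamma (oct A B C D) = oct A B (- C) (- D)"
    and "gammaH (oct A B C D) = oct A (- B) C (- D)"
    and "gammaC (oct A B C D) = oct (cj A) (cj B) (cj C) (cj D)"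
  using assms by (simp_all add: gamma_def gammaH_def gammaC_def oct_in_jordan_iff)
     (simp_all add: oct_def vec_eq_iff gamma0_def gammaH_quat_def gammaC_quat_def)

lemma gammas_involutive:
  "X \<in> jordan \<Longrightarrow> gamma (gamma X) = X" "X \<in> jordan \<Longrightarrow> gammaH (gammaH X) = X"
  "X \<in> jordan \<Longrightarrow> gammaC (gammaC X) = X"
  by (erule jordan_cases, simp add: gamma_oct herm_closed skew_closed)+

lemma gammas_closed:
  "X \<in> jordan \<Longrightarrow> gamma X \<in> jordan" "X \<in> jordan \<Longrightarrow> gammaH X \<in> jordan" "X \<in> jordan \<Longrightarrow> gammaC X \<in> jordan"
  by (erule jordan_cases, simp add: gamma_oct oct_in_jordan_iff herm_closed skew_closed)+

lemma gammas_Bij: "gamma \<in> Bij jordan" "gammaH \<in> Bij jordan" "gammaC \<in> Bij jordan"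
  by (rule involution_Bij; (erule gammas_involutive gammas_closed)?;
      simp add: gamma_def gammaH_def gammaC_def)+

text \<open>For an involution, being fixed under conjugation is the same as commuting with it, the
  form in which the condition is used from here on.\<close>

lemma F4_fixed_iff:
  assumes s: "\<sigma> \<in> Bij jordan" and ss: "\<And>X. X \<in> jordan \<Longrightarrow> \<sigma> (\<sigma> X) = X"
  shows "\<alpha> \<in> F4_fixed \<sigma> \<longleftrightarrow> \<alpha> \<in> carrier F4 \<and> (\<forall>X\<in>jordan. \<alpha> (\<sigma> X) = \<sigma> (\<alpha> X))"
proof (cases "\<alpha> \<in> carrier F4")
  case True
  then have a: "\<alpha> \<in> Bij jordan" by (simp add: F4_def)
  have sas: "\<sigma> \<otimes>\<^bsub>F4\<^esub> \<alpha> \<otimes>\<^bsub>F4\<^esub> \<sigma> = compose jordan (compose jordan \<sigma> \<alpha>) \<sigma>"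
    using s a by (simp add: F4_mult compose_Bij)
  have "compose jordan (compose jordan \<sigma> \<alpha>) \<sigma> = \<alpha> \<longleftrightarrow> (\<forall>X\<in>jordan. \<sigma> (\<alpha> (\<sigma> X)) = \<alpha> X)"
  proof
    assume "\<forall>X\<in>jordan. \<sigma> (\<alpha> (\<sigma> X)) = \<alpha> X"
    then show "compose jordan (compose jordan \<sigma> \<alpha>) \<sigma> = \<alpha>"
      using s a by (intro Bij_eqI) (auto simp: compose_Bij compose_eq Bij_mem)
  qed (metis compose_eq Bij_mem[OF s])
  also have "\<dots> \<longleftrightarrow> (\<forall>X\<in>jordan. \<alpha> (\<sigma> X) = \<sigma> (\<alpha> X))"
    by (metis a s ss Bij_mem)
  finally show ?thesis
    using True by (simp add: F4_fixed_def sas)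
qed (simp add: F4_fixed_def)

definition centralizer :: "(cayley^3^3 \<Rightarrow> cayley^3^3) set" where
  "centralizer = F4_fixed gamma \<inter> F4_fixed gammaH"

lemma centralizer_iff:
  "\<alpha> \<in> centralizer \<longleftrightarrow> \<alpha> \<in> Bij jordan \<and>
     (\<forall>X\<in>jordan. \<forall>Y\<in>jordan. \<alpha> (X + Y) = \<alpha> X + \<alpha> Y) \<and>
     (\<forall>c::real. \<forall>X\<in>jordan. \<alpha> (c *\<^sub>R X) = c *\<^sub>R \<alpha> X) \<and>
     (\<forall>X\<in>jordan. \<forall>Y\<in>jordan. \<alpha> (jmult X Y) = jmult (\<alpha> X) (\<alpha> Y)) \<and>
     (\<forall>X\<in>jordan. \<alpha> (gamma X) = gamma (\<alpha> X)) \<and> (\<forall>X\<in>jordan. \<alpha> (gammaH X) = gammaH (\<alpha> X))"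
  using F4_fixed_iff[OF gammas_Bij(1) gammas_involutive(1), of \<alpha>]
    F4_fixed_iff[OF gammas_Bij(2) gammas_involutive(2), of \<alpha>]
  by (auto simp: centralizer_def F4_def)

section \<open>Known elements of the centralizer\<close>

lemma jordan_closed:
  "X \<in> jordan \<Longrightarrow> Y \<in> jordan \<Longrightarrow> X + Y \<in> jordan" "X \<in> jordan \<Longrightarrow> c *\<^sub>R X \<in> jordan"
  by (auto elim!: jordan_cases simp: oct_add oct_scaleR oct_in_jordan_iff herm_closed skew_closed)

lemma centralizer_compose:
  assumes "\<alpha> \<in> centralizer" "\<beta> \<in> centralizer"
  shows "compose jordan \<alpha> \<beta> \<in> centralizer"
  using assms gammas_Bij[THEN Bij_mem]
  by (simp add: centralizer_iff compose_Bij) (auto simp: compose_eq jordan_closed jmult_closed Bij_mem)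

lemma twist_closed:
  assumes "X \<in> jordan"
  shows "twist U s t r X \<in> jordan"
  using assms by (auto elim!: jordan_cases simp: twist_oct oct_in_jordan_iff herm_congruence
      skew_congruence skew_closed)

lemma twist_twist:
  assumes "X \<in> jordan"
  shows "twist U s t r (twist U' s' t' r' X) = twist (U ** U') (s * s') (t * t') (r * r') X"
  using assms by (auto elim!: jordan_cases simp: twist_oct oct_in_jordan_iff herm_congruence
      skew_congruence skew_closed matrix_transpose_mul matrix_mul_assoc matrix_mult_linear)

lemma twist_one: "X \<in> jordan \<Longrightarrow> twist (mat 1) 1 1 1 X = X"
  by (erule jordan_cases) (simp add: twist_oct)

lemma twist_in_centralizer:
  assumes ad: "admissible U s t r"
  shows "twist U s t r \<in> centralizer"
proof -
  have U: "U \<in> carrier U3" "cnj s * s = 1" "cnj t * t = 1" "cnj r * r = 1"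
    using ad by (auto simp: admissible_def)
  have "bij_betw (twist U s t r) jordan jordan"
  \<comment> \<open>The inverse carries the inverse parameters, which for unitary data are the
    adjoint and the conjugates.\<close>
  proof (rule bij_betw_byWitness[where f' = "twist (adj U) (cnj s) (cnj t) (cnj r)"])
    show "\<forall>X\<in>jordan. twist (adj U) (cnj s) (cnj t) (cnj r) (twist U s t r X) = X"
      using U by (simp add: twist_twist U3_cancel twist_one)
    show "\<forall>X\<in>jordan. twist U s t r (twist (adj U) (cnj s) (cnj t) (cnj r) X) = X"
      using U by (simp add: twist_twist U3_cancel twist_one mult.commute)
  qed (auto simp: twist_closed)
  then have "twist U s t r \<in> Bij jordan"
    by (simp add: Bij_def twist_def)
  moreover have "twist U s t r (X + Y) = twist U s t r X + twist U s t r Y"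
    if "X \<in> jordan" "Y \<in> jordan" for X Y
    using that by (auto elim!: jordan_cases simp: oct_add twist_oct herm_closed skew_closed
        matrix_mult_linear smul_distrib)
  moreover have "twist U s t r (c *\<^sub>R X) = c *\<^sub>R twist U s t r X" if "X \<in> jordan" for c X
    using that by (auto elim!: jordan_cases simp: oct_scaleR twist_oct herm_closed skew_closed
        matrix_mult_linear smul_distrib)
  moreover have "twist U s t r (gamma X) = gamma (twist U s t r X)"
    "twist U s t r (gammaH X) = gammaH (twist U s t r X)" if "X \<in> jordan" for X
    using that by (auto elim!: jordan_cases simp: gamma_oct twist_oct herm_closed skew_closed
        herm_congruence skew_congruence matrix_mult_linear smul_distrib)
  ultimately show ?thesis
    using twist_jmult[OF ad] by (simp add: centralizer_iff)
qed

text \<open>Conjugating all four components respects the product because its coordinate formula has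
  only real coefficients.\<close>

lemma gammaC_in_centralizer: "gammaC \<in> centralizer"
proof -
  have "gammaC (X + Y) = gammaC X + gammaC Y" "gammaC (jmult X Y) = jmult (gammaC X) (gammaC Y)"
    if "X \<in> jordan" "Y \<in> jordan" for X Y
    using that jmult_closed[OF that]
    by (auto elim!: jordan_cases simp: oct_add gamma_oct jmult_oct oct_scaleR
        oct_in_jordan_iff herm_closed skew_closed)
  moreover have "gammaC (c *\<^sub>R X) = c *\<^sub>R gammaC X" "gammaC (gamma X) = gamma (gammaC X)"
    "gammaC (gammaH X) = gammaH (gammaC X)" if "X \<in> jordan" for c X
    using that by (auto elim!: jordan_cases simp: oct_scaleR gamma_oct herm_closed skew_closed)
  ultimately show ?thesis
    using gammas_Bij(3) by (simp add: centralizer_iff)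
qed

section \<open>Decomposition of an element of the centralizer\<close>

text \<open>Serves to kill components that equal their own negatives.\<close>

lemma double_eq_0_iff: "2 * C = 0 \<longleftrightarrow> C = 0" for C :: "complex^3^3"
proof -
  have "2 * C = 2 *\<^sub>R C" by (metis mult_2 scaleR_2)
  then show ?thesis by simp
qed

text \<open>The component maps are pinned down only on \<open>herm\<close> and \<open>skew\<close>;
  elsewhere they are arbitrary, so what is proved about them carries membership hypotheses.\<close>

definition splits :: "(cayley^3^3 \<Rightarrow> cayley^3^3) \<Rightarrow> (complex^3^3 \<Rightarrow> complex^3^3) \<Rightarrow>
    (complex^3^3 \<Rightarrow> complex^3^3) \<Rightarrow> (complex^3^3 \<Rightarrow> complex^3^3) \<Rightarrow> (complex^3^3 \<Rightarrow> complex^3^3) \<Rightarrow> bool" where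
  "splits \<alpha> f g\<^sub>1 g\<^sub>2 g\<^sub>3 \<longleftrightarrow> (\<forall>A\<in>herm. f A \<in> herm) \<and>
     (\<forall>B\<in>skew. g\<^sub>1 B \<in> skew \<and> g\<^sub>2 B \<in> skew \<and> g\<^sub>3 B \<in> skew) \<and>
     (\<forall>A\<in>herm. \<forall>B\<in>skew. \<forall>C\<in>skew. \<forall>D\<in>skew. \<alpha> (oct A B C D) = oct (f A) (g\<^sub>1 B) (g\<^sub>2 C) (g\<^sub>3 D))"

text \<open>The pair \<open>gamma\<close>, \<open>gammaH\<close> acts on the four components by the
  sign pairs (+,+), (+,-), (-,+), (-,-). A map commuting with both preserves each joint eigenspace,
  since every component with a wrong sign equals its own negative. Additivity then reassembles the
  four pieces.\<close>

lemma centralizer_splits: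
  assumes "\<alpha> \<in> centralizer"
  obtains f g\<^sub>1 g\<^sub>2 g\<^sub>3 where "splits \<alpha> f g\<^sub>1 g\<^sub>2 g\<^sub>3"
proof -
  have al: "\<And>X. X \<in> jordan \<Longrightarrow> \<alpha> X \<in> jordan"
    "\<And>X Y. X \<in> jordan \<Longrightarrow> Y \<in> jordan \<Longrightarrow> \<alpha> (X + Y) = \<alpha> X + \<alpha> Y"
    "\<And>c X. X \<in> jordan \<Longrightarrow> \<alpha> (c *\<^sub>R X) = c *\<^sub>R \<alpha> X"
    "\<And>X. X \<in> jordan \<Longrightarrow> \<alpha> (gamma X) = gamma (\<alpha> X)"
    "\<And>X. X \<in> jordan \<Longrightarrow> \<alpha> (gammaH X) = gammaH (\<alpha> X)"
    using assms by (auto simp: centralizer_iff Bij_mem)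
  have m: "\<alpha> (- X) = - \<alpha> X" if "X \<in> jordan" for X
    using al(3)[OF that, of "-1"] by simp
  have mo: "- oct A B C D = oct (- A) (- B) (- C) (- D)" for A B C D
    using oct_scaleR[of "-1" A B C D] by simp
  have "\<exists>A'. A' \<in> herm \<and> \<alpha> (oct A 0 0 0) = oct A' 0 0 0" if "A \<in> herm" for A
  proof -
    have j: "oct A 0 0 0 \<in> jordan" using that by (simp add: oct_in_jordan_iff skew_closed)
    obtain P Q R S where e: "\<alpha> (oct A 0 0 0) = oct P Q R S"
      and h: "P \<in> herm" "Q \<in> skew" "R \<in> skew" "S \<in> skew" using jordan_cases[OF al(1)[OF j]] .
    show ?thesis
      using al(4,5)[OF j] that h by (simp add: gamma_oct e skew_closed double_eq_0_iff)
  qed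
  then obtain f where f: "\<And>A. A \<in> herm \<Longrightarrow> f A \<in> herm" "\<And>A. A \<in> herm \<Longrightarrow> \<alpha> (oct A 0 0 0) = oct (f A) 0 0 0"
    by metis
  have "\<exists>B'. B' \<in> skew \<and> \<alpha> (oct 0 B 0 0) = oct 0 B' 0 0" if "B \<in> skew" for B
  proof -
    have j: "oct 0 B 0 0 \<in> jordan" using that by (simp add: oct_in_jordan_iff skew_closed herm_closed)
    obtain P Q R S where e: "\<alpha> (oct 0 B 0 0) = oct P Q R S"
      and h: "P \<in> herm" "Q \<in> skew" "R \<in> skew" "S \<in> skew" using jordan_cases[OF al(1)[OF j]] .
    have "gamma (oct 0 B 0 0) = oct 0 B 0 0" "gammaH (oct 0 B 0 0) = - oct 0 B 0 0"
      using that by (simp_all add: gamma_oct mo skew_closed herm_closed)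
    then have "gamma (\<alpha> (oct 0 B 0 0)) = \<alpha> (oct 0 B 0 0)" "gammaH (\<alpha> (oct 0 B 0 0)) = - \<alpha> (oct 0 B 0 0)"
      using al(4,5)[OF j] m[OF j] by metis+
    then show ?thesis
      using h by (simp add: gamma_oct e mo double_eq_0_iff)
  qed
  then obtain g\<^sub>1 where g1: "\<And>A. A \<in> skew \<Longrightarrow> g\<^sub>1 A \<in> skew" "\<And>A. A \<in> skew \<Longrightarrow> \<alpha> (oct 0 A 0 0) = oct 0 (g\<^sub>1 A) 0 0"
    by metis
  have "\<exists>B'. B' \<in> skew \<and> \<alpha> (oct 0 0 B 0) = oct 0 0 B' 0" if "B \<in> skew" for B
  proof -
    have j: "oct 0 0 B 0 \<in> jordan" using that by (simp add: oct_in_jordan_iff skew_closed herm_closed)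
    obtain P Q R S where e: "\<alpha> (oct 0 0 B 0) = oct P Q R S"
      and h: "P \<in> herm" "Q \<in> skew" "R \<in> skew" "S \<in> skew" using jordan_cases[OF al(1)[OF j]] .
    have "gamma (oct 0 0 B 0) = - oct 0 0 B 0" "gammaH (oct 0 0 B 0) = oct 0 0 B 0"
      using that by (simp_all add: gamma_oct mo skew_closed herm_closed)
    then have "gamma (\<alpha> (oct 0 0 B 0)) = - \<alpha> (oct 0 0 B 0)" "gammaH (\<alpha> (oct 0 0 B 0)) = \<alpha> (oct 0 0 B 0)"
      using al(4,5)[OF j] m[OF j] by metis+
    then show ?thesis
      using h by (simp add: gamma_oct e mo double_eq_0_iff)
  qed
  then obtain g\<^sub>2 where g2: "\<And>A. A \<in> skew \<Longrightarrow> g\<^sub>2 A \<in> skew" "\<And>A. A \<in> skew \<Longrightarrow> \<alpha> (oct 0 0 A 0) = oct 0 0 (g\<^sub>2 A) 0"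
    by metis
  have "\<exists>B'. B' \<in> skew \<and> \<alpha> (oct 0 0 0 B) = oct 0 0 0 B'" if "B \<in> skew" for B
  proof -
    have j: "oct 0 0 0 B \<in> jordan" using that by (simp add: oct_in_jordan_iff skew_closed herm_closed)
    obtain P Q R S where e: "\<alpha> (oct 0 0 0 B) = oct P Q R S"
      and h: "P \<in> herm" "Q \<in> skew" "R \<in> skew" "S \<in> skew" using jordan_cases[OF al(1)[OF j]] .
    have "gamma (oct 0 0 0 B) = - oct 0 0 0 B" "gammaH (oct 0 0 0 B) = - oct 0 0 0 B"
      using that by (simp_all add: gamma_oct mo skew_closed herm_closed)
    then have "gamma (\<alpha> (oct 0 0 0 B)) = - \<alpha> (oct 0 0 0 B)" "gammaH (\<alpha> (oct 0 0 0 B)) = - \<alpha> (oct 0 0 0 B)"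
      using al(4,5)[OF j] m[OF j] by metis+
    then show ?thesis
      using h by (simp add: gamma_oct e mo double_eq_0_iff)
  qed
  then obtain g\<^sub>3 where g3: "\<And>A. A \<in> skew \<Longrightarrow> g\<^sub>3 A \<in> skew" "\<And>A. A \<in> skew \<Longrightarrow> \<alpha> (oct 0 0 0 A) = oct 0 0 0 (g\<^sub>3 A)"
    by metis
  have "\<alpha> (oct A B C D) = oct (f A) (g\<^sub>1 B) (g\<^sub>2 C) (g\<^sub>3 D)"
    if h: "A \<in> herm" "B \<in> skew" "C \<in> skew" "D \<in> skew" for A B C D
  proof -
    have e: "oct A B C D = oct A 0 0 0 + (oct 0 B 0 0 + (oct 0 0 C 0 + oct 0 0 0 D))"
      by (simp add: oct_add)
    have "oct A 0 0 0 \<in> jordan" "oct 0 B 0 0 \<in> jordan" "oct 0 0 C 0 \<in> jordan" "oct 0 0 0 D \<in> jordan"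
      using h by (simp_all add: oct_in_jordan_iff skew_closed herm_closed)
    then have "\<alpha> (oct A B C D) = \<alpha> (oct A 0 0 0) + (\<alpha> (oct 0 B 0 0) + (\<alpha> (oct 0 0 C 0) + \<alpha> (oct 0 0 0 D)))"
      unfolding e by (simp add: al(2) jordan_closed)
    also have "\<dots> = oct (f A) (g\<^sub>1 B) (g\<^sub>2 C) (g\<^sub>3 D)"
      using h by (simp add: f g1 g2 g3 oct_add)
    finally show ?thesis .
  qed
  then have "splits \<alpha> f g\<^sub>1 g\<^sub>2 g\<^sub>3"
    using f(1) g1(1) g2(1) g3(1) by (simp add: splits_def)
  then show thesis by (rule that)
qed

text \<open>Each law is read off in one slot with zero in the others; the last claim comes from
  injectivity of \<alpha>.\<close>

lemma splits_linear:
  assumes al: "\<alpha> \<in> centralizer" and sp: "splits \<alpha> f g\<^sub>1 g\<^sub>2 g\<^sub>3"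
  shows "A \<in> herm \<Longrightarrow> A' \<in> herm \<Longrightarrow> f (A + A') = f A + f A'" "A \<in> herm \<Longrightarrow> f (c *\<^sub>R A) = c *\<^sub>R f A"
    "B \<in> skew \<Longrightarrow> B' \<in> skew \<Longrightarrow> g\<^sub>1 (B + B') = g\<^sub>1 B + g\<^sub>1 B'" "B \<in> skew \<Longrightarrow> g\<^sub>1 (c *\<^sub>R B) = c *\<^sub>R g\<^sub>1 B"
    "B \<in> skew \<Longrightarrow> B' \<in> skew \<Longrightarrow> g\<^sub>2 (B + B') = g\<^sub>2 B + g\<^sub>2 B'" "B \<in> skew \<Longrightarrow> g\<^sub>2 (c *\<^sub>R B) = c *\<^sub>R g\<^sub>2 B"
    "B \<in> skew \<Longrightarrow> B' \<in> skew \<Longrightarrow> g\<^sub>3 (B + B') = g\<^sub>3 B + g\<^sub>3 B'" "B \<in> skew \<Longrightarrow> g\<^sub>3 (c *\<^sub>R B) = c *\<^sub>R g\<^sub>3 B"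
    "f 0 = 0" "g\<^sub>1 0 = 0" "g\<^sub>2 0 = 0" "g\<^sub>3 0 = 0"
    "A \<in> herm \<Longrightarrow> f A = 0 \<Longrightarrow> A = 0"
proof -
  have sp': "\<alpha> (oct A B C D) = oct (f A) (g\<^sub>1 B) (g\<^sub>2 C) (g\<^sub>3 D)"
    if "A \<in> herm" "B \<in> skew" "C \<in> skew" "D \<in> skew" for A B C D
    using sp that by (simp add: splits_def)
  have add: "oct (f (A + A')) (g\<^sub>1 (B + B')) (g\<^sub>2 (B + B')) (g\<^sub>3 (B + B')) =
     oct (f A + f A') (g\<^sub>1 B + g\<^sub>1 B') (g\<^sub>2 B + g\<^sub>2 B') (g\<^sub>3 B + g\<^sub>3 B')"
    if "A \<in> herm" "A' \<in> herm" "B \<in> skew" "B' \<in> skew" for A A' B B'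
    using al that unfolding centralizer_iff
    by (metis oct_add sp' herm_closed(1) skew_closed(1) oct_in_jordan_iff)
  have scale: "oct (f (c *\<^sub>R A)) (g\<^sub>1 (c *\<^sub>R B)) (g\<^sub>2 (c *\<^sub>R B)) (g\<^sub>3 (c *\<^sub>R B)) =
     oct (c *\<^sub>R f A) (c *\<^sub>R g\<^sub>1 B) (c *\<^sub>R g\<^sub>2 B) (c *\<^sub>R g\<^sub>3 B)"
    if "A \<in> herm" "B \<in> skew" for A B c
    using al that unfolding centralizer_iff
    by (metis oct_scaleR sp' herm_closed(3) skew_closed(4) oct_in_jordan_iff)
  show "A \<in> herm \<Longrightarrow> A' \<in> herm \<Longrightarrow> f (A + A') = f A + f A'"
    "B \<in> skew \<Longrightarrow> B' \<in> skew \<Longrightarrow> g\<^sub>1 (B + B') = g\<^sub>1 B + g\<^sub>1 B'"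
    "B \<in> skew \<Longrightarrow> B' \<in> skew \<Longrightarrow> g\<^sub>2 (B + B') = g\<^sub>2 B + g\<^sub>2 B'"
    "B \<in> skew \<Longrightarrow> B' \<in> skew \<Longrightarrow> g\<^sub>3 (B + B') = g\<^sub>3 B + g\<^sub>3 B'"
    using add[of A A' 0 0] add[of 0 0 B B'] by (simp_all add: herm_closed skew_closed)
  show "A \<in> herm \<Longrightarrow> f (c *\<^sub>R A) = c *\<^sub>R f A" "B \<in> skew \<Longrightarrow> g\<^sub>1 (c *\<^sub>R B) = c *\<^sub>R g\<^sub>1 B"
    "B \<in> skew \<Longrightarrow> g\<^sub>2 (c *\<^sub>R B) = c *\<^sub>R g\<^sub>2 B" "B \<in> skew \<Longrightarrow> g\<^sub>3 (c *\<^sub>R B) = c *\<^sub>R g\<^sub>3 B"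
    using scale[of A 0 c] scale[of 0 B c] by (simp_all add: herm_closed skew_closed)
  show z: "f 0 = 0" "g\<^sub>1 0 = 0" "g\<^sub>2 0 = 0" "g\<^sub>3 0 = 0"
    using scale[of 0 0 0] by (simp_all add: herm_closed skew_closed)
  show "A = 0" if "A \<in> herm" "f A = 0"
  proof -
    have "\<alpha> (oct A 0 0 0) = \<alpha> (oct 0 0 0 0)"
      using that by (simp add: sp' herm_closed skew_closed z)
    moreover have "inj_on \<alpha> jordan"
      using al by (simp add: centralizer_iff Bij_def bij_betw_def)
    ultimately have "oct A 0 0 0 = oct 0 0 0 0"
      using that by (auto simp: oct_in_jordan_iff herm_closed skew_closed dest!: inj_onD)
    then show ?thesis by simp
  qed
qed

text \<open>Each identity is the automorphism law for two elements with a single nonzero component,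
  read in the component that contains their product.\<close>

lemma splits_bracket:
  assumes al: "\<alpha> \<in> centralizer" and sp: "splits \<alpha> f g\<^sub>1 g\<^sub>2 g\<^sub>3"
  shows "A \<in> herm \<Longrightarrow> A' \<in> herm \<Longrightarrow> f (A ** A' + A' ** A) = f A ** f A' + f A' ** f A"
    "A \<in> herm \<Longrightarrow> B \<in> skew \<Longrightarrow> g\<^sub>1 (A ** B + B ** cj A) = f A ** g\<^sub>1 B + g\<^sub>1 B ** cj (f A)"
    "A \<in> herm \<Longrightarrow> B \<in> skew \<Longrightarrow> g\<^sub>2 (A ** B + B ** cj A) = f A ** g\<^sub>2 B + g\<^sub>2 B ** cj (f A)"
    "A \<in> herm \<Longrightarrow> B \<in> skew \<Longrightarrow> g\<^sub>3 (A ** B + B ** cj A) = f A ** g\<^sub>3 B + g\<^sub>3 B ** cj (f A)"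
    "B \<in> skew \<Longrightarrow> B' \<in> skew \<Longrightarrow> f (B ** cj B' + B' ** cj B) = g\<^sub>1 B ** cj (g\<^sub>1 B') + g\<^sub>1 B' ** cj (g\<^sub>1 B)"
    "B \<in> skew \<Longrightarrow> B' \<in> skew \<Longrightarrow> f (B ** cj B' + B' ** cj B) = g\<^sub>2 B ** cj (g\<^sub>2 B') + g\<^sub>2 B' ** cj (g\<^sub>2 B)"
    "B \<in> skew \<Longrightarrow> B' \<in> skew \<Longrightarrow> f (B ** cj B' + B' ** cj B) = g\<^sub>3 B ** cj (g\<^sub>3 B') + g\<^sub>3 B' ** cj (g\<^sub>3 B)"
    "C \<in> skew \<Longrightarrow> D \<in> skew \<Longrightarrow> g\<^sub>1 (cj (C ** D - D ** C)) = cj (g\<^sub>2 C ** g\<^sub>3 D - g\<^sub>3 D ** g\<^sub>2 C)"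
proof -
  have sp': "\<alpha> (oct A B C D) = oct (f A) (g\<^sub>1 B) (g\<^sub>2 C) (g\<^sub>3 D)"
    if "A \<in> herm" "B \<in> skew" "C \<in> skew" "D \<in> skew" for A B C D
    using sp that by (simp add: splits_def)
  note lin = splits_linear[OF al sp]
  \<comment> \<open>Doubling clears the factor one half in \<open>jmult\<close>.\<close>
  have mul: "\<alpha> (2 *\<^sub>R jmult X Y) = 2 *\<^sub>R jmult (\<alpha> X) (\<alpha> Y)" if "X \<in> jordan" "Y \<in> jordan" for X Y
    using al that jmult_closed[OF that] by (simp add: centralizer_iff)
  have neg: "f (- A) = - f A" if "A \<in> herm" for A
    using lin(2)[OF that, of "-1"] by simp
  have mem: "oct A B C D \<in> jordan" if "A \<in> herm" "B \<in> skew" "C \<in> skew" "D \<in> skew" for A B C D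
    using that by (simp add: oct_in_jordan_iff)
  note simps = jmult_oct herm_closed skew_closed bracket_closed matrix_mult_linear sp' lin(9-12) neg
  show "f (A ** A' + A' ** A) = f A ** f A' + f A' ** f A" if h: "A \<in> herm" "A' \<in> herm"
    using mul[OF mem mem, of A 0 0 0 A' 0 0 0] h by (simp add: simps del: cj_diff cj_mult)
  show "g\<^sub>1 (A ** B + B ** cj A) = f A ** g\<^sub>1 B + g\<^sub>1 B ** cj (f A)" if h: "A \<in> herm" "B \<in> skew"
    using mul[OF mem mem, of A 0 0 0 0 B 0 0] h by (simp add: simps del: cj_diff cj_mult)
  show "g\<^sub>2 (A ** B + B ** cj A) = f A ** g\<^sub>2 B + g\<^sub>2 B ** cj (f A)" if h: "A \<in> herm" "B \<in> skew"
    using mul[OF mem mem, of A 0 0 0 0 0 B 0] h by (simp add: simps del: cj_diff cj_mult)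
  show "g\<^sub>3 (A ** B + B ** cj A) = f A ** g\<^sub>3 B + g\<^sub>3 B ** cj (f A)" if h: "A \<in> herm" "B \<in> skew"
    using mul[OF mem mem, of A 0 0 0 0 0 0 B] h by (simp add: simps del: cj_diff cj_mult)
  \<comment> \<open>Products of two skew components enter the Hermitian part with a minus sign; this
    moves the sign outside \<open>f\<close>.\<close>
  have neg': "f (- A - A') = - f (A + A')" "- A - A' \<in> herm" if "A + A' \<in> herm" for A A'
    using neg[OF that] herm_closed(3)[OF that, of "-1"] by simp_all
  show "f (B ** cj B' + B' ** cj B) = g\<^sub>1 B ** cj (g\<^sub>1 B') + g\<^sub>1 B' ** cj (g\<^sub>1 B)" if h: "B \<in> skew" "B' \<in> skew"
  proof -
    have "- f (B ** cj B' + B' ** cj B) = - (g\<^sub>1 B ** cj (g\<^sub>1 B') + g\<^sub>1 B' ** cj (g\<^sub>1 B))"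
      using mul[OF mem mem, of 0 B 0 0 0 B' 0 0] h neg'[OF bracket_closed(2)[OF h]]
      by (simp add: simps del: cj_diff cj_mult)
    then show ?thesis by (simp only: neg_equal_iff_equal)
  qed
  show "f (B ** cj B' + B' ** cj B) = g\<^sub>2 B ** cj (g\<^sub>2 B') + g\<^sub>2 B' ** cj (g\<^sub>2 B)" if h: "B \<in> skew" "B' \<in> skew"
  proof -
    have "- f (B ** cj B' + B' ** cj B) = - (g\<^sub>2 B ** cj (g\<^sub>2 B') + g\<^sub>2 B' ** cj (g\<^sub>2 B))"
      using mul[OF mem mem, of 0 0 B 0 0 0 B' 0] h neg'[OF bracket_closed(2)[OF h]]
      by (simp add: simps del: cj_diff cj_mult)
    then show ?thesis by (simp only: neg_equal_iff_equal)
  qed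
  show "f (B ** cj B' + B' ** cj B) = g\<^sub>3 B ** cj (g\<^sub>3 B') + g\<^sub>3 B' ** cj (g\<^sub>3 B)" if h: "B \<in> skew" "B' \<in> skew"
  proof -
    have "- f (B ** cj B' + B' ** cj B) = - (g\<^sub>3 B ** cj (g\<^sub>3 B') + g\<^sub>3 B' ** cj (g\<^sub>3 B))"
      using mul[OF mem mem, of 0 0 0 B 0 0 0 B'] h neg'[OF bracket_closed(2)[OF h]]
      by (simp add: simps del: cj_diff cj_mult)
    then show ?thesis by (simp only: neg_equal_iff_equal)
  qed
  show "g\<^sub>1 (cj (C ** D - D ** C)) = cj (g\<^sub>2 C ** g\<^sub>3 D - g\<^sub>3 D ** g\<^sub>2 C)" if h: "C \<in> skew" "D \<in> skew"
    using mul[OF mem mem, of 0 0 C 0 0 0 0 D] h by (simp add: simps del: cj_diff cj_mult)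
qed

section \<open>Rigidity of the components\<close>

text \<open>Off-diagonal entries are numbered by the index they omit: \<open>x\<close> sits at
  (2,3), \<open>y\<close> at (1,3) and \<open>z\<close> at (1,2), in \<open>kmat\<close> as well.
  This makes the relations between the three coordinates uniform.\<close>

definition hmat :: "real \<Rightarrow> real \<Rightarrow> real \<Rightarrow> complex \<Rightarrow> complex \<Rightarrow> complex \<Rightarrow> complex^3^3" where
  "hmat a b c x y z = vector [vector [of_real a, z, y], vector [cnj z, of_real b, x], vector [cnj y, cnj x, of_real c]]"

definition kmat :: "complex \<Rightarrow> complex \<Rightarrow> complex \<Rightarrow> complex^3^3" where
  "kmat x y z = vector [vector [0, z, y], vector [- z, 0, x], vector [- y, - x, 0]]"

lemma hmat_nth:
  "hmat a b c x y z $ 1 = vector [of_real a, z, y]" "hmat a b c x y z $ 2 = vector [cnj z, of_real b, x]"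
  "hmat a b c x y z $ 3 = vector [cnj y, cnj x, of_real c]"
  by (simp_all add: hmat_def)

lemma kmat_nth:
  "kmat x y z $ 1 = vector [0, z, y]" "kmat x y z $ 2 = vector [- z, 0, x]"
  "kmat x y z $ 3 = vector [- y, - x, 0]"
  by (simp_all add: kmat_def)

lemma hmat_eq_iff [simp]:
  "hmat a b c x y z = hmat a' b' c' x' y' z' \<longleftrightarrow> a = a' \<and> b = b' \<and> c = c' \<and> x = x' \<and> y = y' \<and> z = z'"
  by (auto simp: vec_eq_iff forall_3 hmat_nth)

lemma kmat_eq_iff [simp]: "kmat x y z = kmat x' y' z' \<longleftrightarrow> x = x' \<and> y = y' \<and> z = z'"
  by (auto simp: vec_eq_iff forall_3 kmat_nth)

lemma hmat_herm [simp]: "hmat a b c x y z \<in> herm"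
  by (simp add: herm_def vec_eq_iff forall_3 hmat_nth transpose_def)

lemma kmat_skew [simp]: "kmat x y z \<in> skew"
  by (simp add: skew_def vec_eq_iff forall_3 kmat_nth transpose_def)

lemma herm_cases:
  assumes "A \<in> herm"
  obtains a b c x y z where "A = hmat a b c x y z"
proof
  have "A $ i $ i = of_real (Re (A $ i $ i))" for i
    using herm_entries[OF assms, of i i] by (metis Reals_cnj_iff of_real_Re)
  then show "A = hmat (Re (A $ 1 $ 1)) (Re (A $ 2 $ 2)) (Re (A $ 3 $ 3)) (A $ 2 $ 3) (A $ 1 $ 3) (A $ 1 $ 2)"
    using herm_entries[OF assms, of 2 1] herm_entries[OF assms, of 3 1] herm_entries[OF assms, of 3 2]
    by (simp add: vec_eq_iff forall_3 hmat_nth)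
qed

lemma skew_cases:
  assumes "B \<in> skew"
  obtains x y z where "B = kmat x y z"
proof
  show "B = kmat (B $ 2 $ 3) (B $ 1 $ 3) (B $ 1 $ 2)"
    by (simp add: vec_eq_iff forall_3 kmat_nth skew_expand[OF assms])
qed

lemma hmat_add:
  "hmat a b c x y z + hmat a' b' c' x' y' z' = hmat (a + a') (b + b') (c + c') (x + x') (y + y') (z + z')"
  by (simp add: vec_eq_iff forall_3 hmat_nth)

lemma hmat_scaleR: "d *\<^sub>R hmat a b c x y z = hmat (d * a) (d * b) (d * c) (d *\<^sub>R x) (d *\<^sub>R y) (d *\<^sub>R z)"
  by (simp add: vec_eq_iff forall_3 hmat_nth complex_eq_iff)

lemma hmat_0: "0 = hmat 0 0 0 0 0 0"
  by (simp add: vec_eq_iff forall_3 hmat_nth)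

lemma cj_hmat: "cj (hmat a b c x y z) = hmat a b c (cnj x) (cnj y) (cnj z)"
  by (simp add: vec_eq_iff forall_3 hmat_nth)

lemma kmat_add: "kmat x y z + kmat x' y' z' = kmat (x + x') (y + y') (z + z')"
  by (simp add: vec_eq_iff forall_3 kmat_nth)

lemma kmat_0: "0 = kmat 0 0 0"
  by (simp add: vec_eq_iff forall_3 kmat_nth)

lemma smul_kmat: "smul s (kmat x y z) = kmat (s * x) (s * y) (s * z)"
  by (simp add: vec_eq_iff forall_3 kmat_nth smul_def)

lemma cj_kmat: "cj (kmat x y z) = kmat (cnj x) (cnj y) (cnj z)"
  by (simp add: vec_eq_iff forall_3 kmat_nth)

lemma of_real_double_Re: "complex_of_real (2 * Re w) = w + cnj w"
  by (simp add: complex_eq_iff)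

lemma hmat_bracket:
  "hmat a b c x y z ** hmat a' b' c' x' y' z' + hmat a' b' c' x' y' z' ** hmat a b c x y z =
   hmat (2 * (a * a') + 2 * Re (z * cnj z') + 2 * Re (y * cnj y'))
        (2 * (b * b') + 2 * Re (z * cnj z') + 2 * Re (x * cnj x'))
        (2 * (c * c') + 2 * Re (y * cnj y') + 2 * Re (x * cnj x'))
        (cnj z * y' + b * x' + x * c' + cnj z' * y + b' * x + x' * c)
        (a * y' + z * x' + y * c' + a' * y + z' * x + y' * c)
        (a * z' + z * b' + y * cnj x' + a' * z + z' * b + y' * cnj x)"
  by (simp add: vec_eq_iff forall_3 hmat_nth matrix_matrix_mult_def sum_3 algebra_simps of_real_double_Re
      del: of_real_mult times_complex.sel)
    (simp add: complex_eq_iff algebra_simps)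

lemma hmat_kmat_bracket:
  "hmat a b c x y z ** kmat u v w + kmat u v w ** cj (hmat a b c x y z) =
   kmat ((b + c) * u + cnj z * v - cnj y * w) ((a + c) * v + z * u + cnj x * w) ((a + b) * w - y * u + x * v)"
  by (simp add: vec_eq_iff forall_3 hmat_nth kmat_nth matrix_matrix_mult_def sum_3 algebra_simps)

lemma kmat_square: "kmat u 0 0 ** cj (kmat u 0 0) = - hmat 0 ((cmod u)\<^sup>2) ((cmod u)\<^sup>2) 0 0 0"
  by (simp add: vec_eq_iff forall_3 hmat_nth kmat_nth matrix_matrix_mult_def sum_3 complex_norm_square[symmetric])

lemma kmat_commutator: "kmat u 0 0 ** kmat 0 v 0 - kmat 0 v 0 ** kmat u 0 0 = kmat 0 0 (u * v)"
  by (simp add: vec_eq_iff forall_3 kmat_nth matrix_matrix_mult_def sum_3 algebra_simps)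

text \<open>A Schur-type argument from additivity alone. Diagonal \<open>A\<close> separate the
  three coordinates, and an \<open>A\<close> with one off-diagonal pair carries one coordinate to
  another, multiplied by an arbitrary complex number. This yields complex linearity and a common
  scalar at once.\<close>

lemma equivariant_is_scalar:
  assumes g: "\<And>B. B \<in> skew \<Longrightarrow> g B \<in> skew" and add: "\<And>B C. B \<in> skew \<Longrightarrow> C \<in> skew \<Longrightarrow> g (B + C) = g B + g C"
    and eq: "\<And>A B. A \<in> herm \<Longrightarrow> B \<in> skew \<Longrightarrow> g (A ** B + B ** cj A) = A ** g B + g B ** cj A"
  obtains s where "\<And>B. B \<in> skew \<Longrightarrow> g B = smul s B"
proof -
  have gk: "\<exists>x y z. g (kmat u v w) = kmat x y z" for u v w
    using skew_cases[OF g[OF kmat_skew]] by metis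
  have br: "g (kmat ((b + c) * u + cnj z * v - cnj y * w) ((a + c) * v + z * u + cnj x * w) ((a + b) * w - y * u + x * v))
     = hmat a b c x y z ** g (kmat u v w) + g (kmat u v w) ** cj (hmat a b c x y z)" for a b c x y z u v w
    using eq[OF hmat_herm kmat_skew, of a b c x y z u v w] by (simp only: hmat_kmat_bracket)
  have g0: "g 0 = 0"
    using add[of 0 0] by (simp add: skew_closed)
  \<comment> \<open>The bracket with \<open>hmat 1 0 0 0 0 0\<close> kills a \<open>kmat\<close>
    exactly when only its first coordinate can be nonzero, so \<open>g\<close> preserves that
    coordinate. The other two diagonal idempotents treat the other coordinates.\<close>
  have "\<exists>x. g (kmat u 0 0) = kmat x 0 0" for u
    using gk[of u 0 0] br[of 0 0 u 0 0 0 0 1 0] g0 by (auto simp: hmat_kmat_bracket kmat_0)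
  then obtain p where p: "\<And>u. g (kmat u 0 0) = kmat (p u) 0 0" by metis
  have "\<exists>x. g (kmat 0 u 0) = kmat 0 x 0" for u
    using gk[of 0 u 0] br[of 1 0 0 0 u 0 0 0 0] g0 by (auto simp: hmat_kmat_bracket kmat_0)
  then obtain q where q: "\<And>u. g (kmat 0 u 0) = kmat 0 (q u) 0" by metis
  have "\<exists>x. g (kmat 0 0 u) = kmat 0 0 x" for u
    using gk[of 0 0 u] br[of 0 1 0 0 0 0 u 0 0] g0 by (auto simp: hmat_kmat_bracket kmat_0)
  then obtain r where r: "\<And>u. g (kmat 0 0 u) = kmat 0 0 (r u)" by metis
  \<comment> \<open>Here \<open>A\<close> has the single off-diagonal entry \<open>y\<close> at
    (1,2) and its conjugate; it moves the first coordinate to the second.\<close>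
  have qp: "q (y * x) = y * p x" for x y
    using br[of 0 0 x y 0 0 0 0 0] by (simp add: p q hmat_kmat_bracket)
  have qr: "q (cnj y * x) = cnj y * r x" for x y
    using br[of 0 0 0 0 0 0 x 0 y] by (simp add: q r hmat_kmat_bracket)
  have s: "q x = x * p 1" "p x = x * p 1" "r x = x * p 1" for x
    using qp[of 1 x] qp[of x 1] qr[of 1 x] by simp_all
  have "g B = smul (p 1) B" if B: "B \<in> skew" for B
  proof -
    obtain x y z where Bk: "B = kmat x y z" using B by (rule skew_cases)
    have e: "kmat x y z = kmat x 0 0 + (kmat 0 y 0 + kmat 0 0 z)" by (simp add: kmat_add)
    have "g B = g (kmat x 0 0) + (g (kmat 0 y 0) + g (kmat 0 0 z))"
      unfolding Bk e by (simp add: add skew_closed)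
    then show ?thesis
      unfolding Bk p q r s(1)[of y] s(2)[of x] s(3)[of z] by (simp add: kmat_add smul_kmat mult.commute)
  qed
  then show thesis by (rule that)
qed

section \<open>Simultaneous diagonalization of orthogonal projections\<close>

lemma sum_cnj_mult_self:
  fixes u :: "complex^3"
  shows "(\<Sum>i\<in>UNIV. cnj (u $ i) * u $ i) = of_real ((norm u)\<^sup>2)"
  by (simp add: norm_vec_def L2_set_def sum_nonneg complex_norm_square mult.commute del: of_real_power)

text \<open>A projection fixes each of its columns; a nonzero column is normalised.\<close>

lemma projection_unit_vector:
  fixes P :: "complex^3^3"
  assumes "P ** P = P" "P \<noteq> 0"
  obtains u where "P *v u = u" "norm u = 1"
proof -
  obtain j where j: "column j P \<noteq> 0"
    using assms(2) by (auto simp: column_def vec_eq_iff)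
  have "P *v column j P = column j (P ** P)"
    by (simp add: vec_eq_iff column_def matrix_vector_mult_def matrix_matrix_mult_def)
  then have "P *v (inverse (norm (column j P)) *\<^sub>R column j P) = inverse (norm (column j P)) *\<^sub>R column j P"
    by (simp add: assms(1) matrix_vector_mult_def vec_eq_iff flip: scaleR_sum_right)
  moreover have "norm (inverse (norm (column j P)) *\<^sub>R column j P) = 1"
    unfolding norm_scaleR using j by simp
  ultimately show thesis by (rule that)
qed

text \<open>Self-adjointness in coordinates, used to see that vectors fixed by mutually orthogonal
  projections are orthogonal.\<close>

lemma herm_sum_swap:
  assumes "P \<in> herm"
  shows "(\<Sum>i\<in>UNIV. cnj ((P *v u) $ i) * v $ i) = (\<Sum>i\<in>UNIV. cnj (u $ i) * (P *v v) $ i)"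
  using herm_entries[OF assms, of 2 1] herm_entries[OF assms, of 3 1] herm_entries[OF assms, of 3 2]
    herm_entries[OF assms, of 1 1] herm_entries[OF assms, of 2 2] herm_entries[OF assms, of 3 3]
  by (simp add: sum_3 matrix_vector_mult_def algebra_simps)

text \<open>Anticommutation gives \<open>P ** Q = - (P ** Q ** P) = Q ** P\<close>, so the product
  equals its own negative. This recovers honest orthogonality from the symmetrised product, the only
  one that an automorphism respects.\<close>

lemma projections_orthogonal:
  fixes P Q :: "complex^3^3"
  assumes "P ** P = P" "P ** Q + Q ** P = 0"
  shows "P ** Q = 0"
proof -
  have e: "P ** Q = - (Q ** P)" using assms(2) by (simp add: eq_neg_iff_add_eq_0)
  have "P ** Q = P ** (P ** Q)" by (simp add: matrix_mul_assoc assms(1))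
  also have "\<dots> = - (P ** Q ** P)" by (simp add: e matrix_mult_linear matrix_mul_assoc)
  also have "\<dots> = Q ** P" by (simp add: e matrix_mult_linear matrix_mul_assoc[symmetric] assms(1))
  finally have "P ** Q + P ** Q = 0" using e by simp
  then show ?thesis by (simp add: double_eq_0_iff flip: mult_2)
qed

definition idem :: "3 \<Rightarrow> complex^3^3" where "idem k = (\<chi> i j. if i = k \<and> j = k then 1 else 0)"

lemma idem_hmat: "idem 1 = hmat 1 0 0 0 0 0" "idem 2 = hmat 0 1 0 0 0 0" "idem 3 = hmat 0 0 1 0 0 0"
  by (simp_all add: vec_eq_iff forall_3 idem_def hmat_nth)

lemma idem_herm: "idem k \<in> herm"
  by (auto simp: herm_def vec_eq_iff idem_def transpose_def)

lemma idem_mult: "idem k ** idem l = (if k = l then idem k else 0)"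
  by (auto simp: vec_eq_iff idem_def matrix_matrix_mult_def if_distrib if_distribR sum.If_cases)

text \<open>Unit vectors fixed by the three projections are pairwise orthogonal and hence form the
  columns of a unitary \<open>U\<close>. Comparing columns gives
  \<open>P k ** U = U ** idem k\<close>.\<close>

lemma orthogonal_projections_diagonalize:
  fixes P :: "3 \<Rightarrow> complex^3^3"
  assumes h: "\<And>k. P k \<in> herm" and p: "\<And>k. P k ** P k = P k" and nz: "\<And>k. P k \<noteq> 0"
    and o: "\<And>k l. k \<noteq> l \<Longrightarrow> P k ** P l = 0"
  obtains U where "U \<in> carrier U3" "\<And>k. P k = U ** idem k ** adj U"
proof -
  have "\<exists>u. P k *v u = u \<and> norm u = 1" for k
    using projection_unit_vector[OF p nz] by blast
  then obtain u where u: "\<And>k. P k *v u k = u k" "\<And>k. norm (u k) = 1"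
    by metis
  have pu: "P k *v u l = (if k = l then u k else 0)" for k l
  proof (cases "k = l")
    case False
    have "P k *v u l = P k *v (P l *v u l)" by (simp add: u)
    also have "\<dots> = (P k ** P l) *v u l" by (rule matrix_vector_mul_assoc)
    finally show ?thesis using False by (simp add: o)
  qed (simp add: u)
  define U :: "complex^3^3" where "U = (\<chi> i j. u j $ i)"
  have ip: "(\<Sum>i\<in>UNIV. cnj (u k $ i) * u l $ i) = (if k = l then 1 else 0)" for k l
  proof (cases "k = l")
    case False
    have "(\<Sum>i\<in>UNIV. cnj (u k $ i) * u l $ i) = (\<Sum>i\<in>UNIV. cnj ((P k *v u k) $ i) * u l $ i)"
      by (simp add: u)
    also have "\<dots> = (\<Sum>i\<in>UNIV. cnj (u k $ i) * (P k *v u l) $ i)"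
      by (rule herm_sum_swap[OF h])
    finally show ?thesis using False by (simp add: pu)
  qed (simp add: sum_cnj_mult_self u)
  have U: "U \<in> carrier U3"
    by (simp add: U3_iff vec_eq_iff matrix_matrix_mult_def transpose_def U_def ip mat_def)
  have "P k ** U = U ** idem k" for k
  proof -
    have "(P k ** U) $ i $ j = (P k *v u j) $ i" for i j
      by (simp add: matrix_matrix_mult_def matrix_vector_mult_def U_def)
    moreover have "(U ** idem k) $ i $ j = (if k = j then u k $ i else 0)" for i j
      by (simp add: matrix_matrix_mult_def U_def idem_def if_distrib sum.If_cases)
    ultimately show ?thesis by (simp add: vec_eq_iff pu)
  qed
  then have "P k = U ** idem k ** adj U" for k
    by (metis matrix_mul_assoc matrix_mul_rid U3_cancel(3)[OF U])
  with U show thesis by (rule that)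
qed

text \<open>A Peirce decomposition: since the diagonal idempotents are fixed, each off-diagonal
  entry is preserved separately. Squares of such entries give the norm conditions, and products of
  two different ones link \<open>p\<close>, \<open>q\<close> and \<open>r\<close>.\<close>

lemma automorphism_fixing_frame:
  assumes h: "\<And>A. A \<in> herm \<Longrightarrow> f A \<in> herm"
    and add: "\<And>A B. A \<in> herm \<Longrightarrow> B \<in> herm \<Longrightarrow> f (A + B) = f A + f B"
    and scale: "\<And>c A. A \<in> herm \<Longrightarrow> f (c *\<^sub>R A) = c *\<^sub>R f A"
    and br: "\<And>A B. A \<in> herm \<Longrightarrow> B \<in> herm \<Longrightarrow> f (A ** B + B ** A) = f A ** f B + f B ** f A"
    and idem: "\<And>k. f (idem k) = idem k"
  obtains p q r where "\<forall>a b c x y z. f (hmat a b c x y z) = hmat a b c (p x) (q y) (r z)"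
    "\<forall>x. cmod (p x) = cmod x" "\<forall>x. cmod (r x) = cmod x"
    "\<forall>x y. q (x * y) = r x * p y" "\<forall>x y. r (x * cnj y) = q x * cnj (p y)"
    "\<forall>x y. p (x + y) = p x + p y" "\<forall>c x. p (c *\<^sub>R x) = c *\<^sub>R p x"
proof -
  have fi: "f (hmat 1 0 0 0 0 0) = hmat 1 0 0 0 0 0" "f (hmat 0 1 0 0 0 0) = hmat 0 1 0 0 0 0"
    "f (hmat 0 0 1 0 0 0) = hmat 0 0 1 0 0 0"
    using idem[of 1] idem[of 2] idem[of 3] by (simp_all add: idem_hmat)
  have f0: "f (hmat 0 0 0 0 0 0) = hmat 0 0 0 0 0 0"
    using scale[of 0 0] by (simp add: hmat_0[symmetric] herm_closed)
  have fh: "\<exists>a' b' c' x' y' z'. f (hmat a b c x y z) = hmat a' b' c' x' y' z'" for a b c x y z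
    using herm_cases[OF h[OF hmat_herm]] by metis
  note brh = br[OF hmat_herm hmat_herm]
  \<comment> \<open>The (2,3) entry spans the joint eigenspace, for eigenvalue one, of the brackets
    with the second and third idempotents. The next two claims use the other pairs of
    idempotents.\<close>
  have "\<exists>x'. f (hmat 0 0 0 x 0 0) = hmat 0 0 0 x' 0 0" for x
    using fh[of 0 0 0 x 0 0] brh[of 0 1 0 0 0 0 0 0 0 x 0 0] brh[of 0 0 1 0 0 0 0 0 0 x 0 0]
    by (auto simp: hmat_bracket fi f0)
  then obtain p where p: "\<And>x. f (hmat 0 0 0 x 0 0) = hmat 0 0 0 (p x) 0 0" by metis
  have "\<exists>x'. f (hmat 0 0 0 0 x 0) = hmat 0 0 0 0 x' 0" for x
    using fh[of 0 0 0 0 x 0] brh[of 1 0 0 0 0 0 0 0 0 0 x 0] brh[of 0 0 1 0 0 0 0 0 0 0 x 0]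
    by (auto simp: hmat_bracket fi f0)
  then obtain q where q: "\<And>x. f (hmat 0 0 0 0 x 0) = hmat 0 0 0 0 (q x) 0" by metis
  have "\<exists>x'. f (hmat 0 0 0 0 0 x) = hmat 0 0 0 0 0 x'" for x
    using fh[of 0 0 0 0 0 x] brh[of 1 0 0 0 0 0 0 0 0 0 0 x] brh[of 0 1 0 0 0 0 0 0 0 0 0 x]
    by (auto simp: hmat_bracket fi f0)
  then obtain r where r: "\<And>x. f (hmat 0 0 0 0 0 x) = hmat 0 0 0 0 0 (r x)" by metis
  have diag: "f (hmat a b c 0 0 0) = hmat a b c 0 0 0" for a b c
  proof -
    have e: "hmat a b c 0 0 0 = a *\<^sub>R hmat 1 0 0 0 0 0 + (b *\<^sub>R hmat 0 1 0 0 0 0 + c *\<^sub>R hmat 0 0 1 0 0 0)"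
      by (simp add: hmat_add hmat_scaleR)
    have "f (hmat a b c 0 0 0) = a *\<^sub>R f (hmat 1 0 0 0 0 0) + (b *\<^sub>R f (hmat 0 1 0 0 0 0) + c *\<^sub>R f (hmat 0 0 1 0 0 0))"
      unfolding e by (simp only: add scale herm_closed hmat_herm)
    then show ?thesis unfolding fi by (simp add: hmat_add hmat_scaleR)
  qed
  show thesis
  proof (rule that[of p q r]; intro allI)
    show "f (hmat a b c x y z) = hmat a b c (p x) (q y) (r z)" for a b c x y z
    proof -
      have e: "hmat a b c x y z = hmat a b c 0 0 0 + (hmat 0 0 0 x 0 0 + (hmat 0 0 0 0 y 0 + hmat 0 0 0 0 0 z))"
        by (simp add: hmat_add)
      have "f (hmat a b c x y z) = f (hmat a b c 0 0 0) + (f (hmat 0 0 0 x 0 0) + (f (hmat 0 0 0 0 y 0) + f (hmat 0 0 0 0 0 z)))"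
        unfolding e by (simp only: add herm_closed hmat_herm)
      then show ?thesis by (simp add: diag p q r hmat_add)
    qed
    \<comment> \<open>The bracket of the element with itself is diagonal with entries twice the
      squared modulus, and \<open>f\<close> is trivial on diagonal matrices.\<close>
    show "cmod (p x) = cmod x" for x
      using brh[of 0 0 0 x 0 0 0 0 0 x 0 0] by (simp add: hmat_bracket p diag complex_mult_cnj cmod_def power2_eq_square)
    show "cmod (r x) = cmod x" for x
      using brh[of 0 0 0 0 0 x 0 0 0 0 0 x] by (simp add: hmat_bracket r diag complex_mult_cnj cmod_def power2_eq_square)
    show "q (x * y) = r x * p y" for x y
      using brh[of 0 0 0 0 0 x 0 0 0 y 0 0] by (simp add: hmat_bracket p q r)
    show "r (x * cnj y) = q x * cnj (p y)" for x y
      using brh[of 0 0 0 0 x 0 0 0 0 y 0 0] by (simp add: hmat_bracket p q r)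
    show "p (x + y) = p x + p y" for x y
      using add[OF hmat_herm hmat_herm, of 0 0 0 x 0 0 0 0 0 y 0 0] by (simp add: hmat_add p)
    show "p (c *\<^sub>R x) = c *\<^sub>R p x" for c x
      using scale[OF hmat_herm, of c 0 0 0 x 0 0] by (simp add: hmat_scaleR p)
  qed
qed

text \<open>The value at \<i> is a square root of -1, and real linearity extends it.\<close>

lemma real_algebra_endomorphism_complex:
  fixes h :: "complex \<Rightarrow> complex"
  assumes add: "\<And>x y. h (x + y) = h x + h y" and scale: "\<And>c x. h (c *\<^sub>R x) = c *\<^sub>R h x"
    and mult: "\<And>x y. h (x * y) = h x * h y" and one: "h 1 = 1"
  shows "h = id \<or> h = cnj"
proof -
  have "h \<i> * h \<i> = h (- 1 *\<^sub>R 1)"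
    by (subst mult[symmetric]) simp
  also have "\<dots> = - 1" by (subst scale) (simp add: one)
  finally have "(h \<i> - \<i>) * (h \<i> + \<i>) = 0"
    by (simp add: algebra_simps)
  then have i: "h \<i> = \<i> \<or> h \<i> = - \<i>"
    by (auto simp: eq_neg_iff_add_eq_0)
  have e: "h z = of_real (Re z) + of_real (Im z) * h \<i>" for z
  proof -
    have "z = Re z *\<^sub>R 1 + Im z *\<^sub>R \<i>" by (simp add: complex_eq_iff)
    then have "h z = h (Re z *\<^sub>R 1 + Im z *\<^sub>R \<i>)" by (rule arg_cong)
    then show ?thesis by (simp only: add scale one) (simp only: scaleR_conv_of_real mult_1_right)
  qed
  define w where "w = h \<i>"
  have "h = (\<lambda>z. of_real (Re z) + of_real (Im z) * w)"
    unfolding w_def by (rule ext, rule e)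
  moreover have "w = \<i> \<or> w = - \<i>"
    using i by (simp add: w_def)
  ultimately show ?thesis
    by (auto simp: fun_eq_iff complex_eq_iff)
qed

section \<open>The normal form of an element of the centralizer\<close>

text \<open>With \<open>s = 1\<close> and \<open>det U\<close> of modulus one, admissibility fixes
  the product of the other two scalars as \<open>(cnj (det U))\<^sup>2\<close>. The unit
  \<open>p\<close> records how this product is split between them.\<close>

definition phi :: "complex \<times> (complex^3^3) \<Rightarrow> cayley^3^3 \<Rightarrow> cayley^3^3" where
  "phi = (\<lambda>(p, U). twist U 1 (p * cnj (det U)) (cnj p * cnj (det U)))"

lemma U1_iff [simp]: "z \<in> carrier U1 \<longleftrightarrow> cnj z * z = 1"
  by (simp add: U1_def)

lemma U1U3_iff: "(p, U) \<in> carrier (U1 \<times>\<times> U3) \<longleftrightarrow> cnj p * p = 1 \<and> U \<in> carrier U3"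
  by (simp add: DirProd_def U1_def)

lemma phi_in_centralizer:
  assumes "x \<in> carrier (U1 \<times>\<times> U3)"
  shows "phi x \<in> centralizer"
proof -
  obtain p U where x: "x = (p, U)" "cnj p * p = 1" "U \<in> carrier U3"
    using assms U1U3_iff by (cases x) blast
  have d: "cnj (det U) * det U = 1" by (rule U3_det[OF x(3)])
  have "(p * cnj (det U)) * (cnj p * cnj (det U)) * (det U)\<^sup>2 = (cnj p * p) * (cnj (det U) * det U)\<^sup>2"
    by (simp add: power2_eq_square)
  moreover have "cnj (p * cnj (det U)) * (p * cnj (det U)) = (cnj p * p) * (cnj (det U) * det U)"
    "cnj (cnj p * cnj (det U)) * (cnj p * cnj (det U)) = (cnj p * p) * (cnj (det U) * det U)"
    by simp_all
  ultimately have "admissible U 1 (p * cnj (det U)) (cnj p * cnj (det U))"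
    unfolding admissible_def using x d by (simp del: complex_cnj_mult complex_cnj_cnj)
  then show ?thesis
    unfolding x phi_def by (simp add: twist_in_centralizer)
qed

lemma phi_phi:
  assumes "X \<in> jordan"
  shows "phi (p, U) (phi (q, V) X) = phi (p * q, U ** V) X"
  using assms by (simp add: phi_def twist_twist det_mul mult_ac)

lemma phi_one: "X \<in> jordan \<Longrightarrow> phi (1, mat 1) X = X"
  by (simp add: phi_def twist_one)

text \<open>This commutation rule is the source of the action of \<open>Z2C\<close> on the
  parameters.\<close>

lemma gammaC_phi:
  assumes "X \<in> jordan"
  shows "gammaC (phi (p, U) X) = phi (cnj p, cj U) (gammaC X)"
  using assms by (auto elim!: jordan_cases simp: phi_def twist_oct gamma_oct herm_closed skew_closed
    herm_congruence skew_congruence det_cj cj_transpose)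

lemma centralizer_Bij: "\<alpha> \<in> centralizer \<Longrightarrow> \<alpha> \<in> Bij jordan"
  by (simp add: centralizer_iff)

lemma centralizer_mem: "\<alpha> \<in> centralizer \<Longrightarrow> X \<in> jordan \<Longrightarrow> \<alpha> X \<in> jordan"
  by (simp add: centralizer_iff Bij_mem)

definition normal_form :: "(cayley^3^3 \<Rightarrow> cayley^3^3) \<Rightarrow> bool" where
  "normal_form \<alpha> \<longleftrightarrow> (\<exists>x\<in>carrier (U1 \<times>\<times> U3). \<alpha> = phi x \<or> \<alpha> = compose jordan (phi x) gammaC)"

text \<open>Allows the reduction to replace \<alpha> by its composite with a suitable
  \<open>phi x\<close>; the inverse parameters \<open>(cnj p, adj U)\<close> undo the
  change.\<close>

lemma normal_form_phi_cancel:
  assumes x: "x \<in> carrier (U1 \<times>\<times> U3)" and al: "\<alpha> \<in> centralizer" and n: "normal_form (compose jordan (phi x) \<alpha>)"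
  shows "normal_form \<alpha>"
proof -
  obtain p U where xp: "x = (p, U)" "cnj p * p = 1" "U \<in> carrier U3"
    using x U1U3_iff by (cases x) blast
  obtain q V where y: "(q, V) \<in> carrier (U1 \<times>\<times> U3)"
    and yn: "compose jordan (phi x) \<alpha> = phi (q, V) \<or> compose jordan (phi x) \<alpha> = compose jordan (phi (q, V)) gammaC"
    using n unfolding normal_form_def by auto
  have z: "(cnj p * q, adj U ** V) \<in> carrier (U1 \<times>\<times> U3)"
    using xp y unfolding U1U3_iff by (simp add: U3_closed mult_ac) (metis mult.assoc mult.commute mult_1)
  have a: "\<alpha> X = phi (cnj p, adj U) (compose jordan (phi x) \<alpha> X)" if "X \<in> jordan" for X
    using that xp by (simp add: compose_eq phi_phi centralizer_mem[OF al] U3_cancel phi_one)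
  note B = centralizer_Bij[OF al] centralizer_Bij[OF phi_in_centralizer[OF z]]
  from yn have "\<alpha> = phi (cnj p * q, adj U ** V) \<or> \<alpha> = compose jordan (phi (cnj p * q, adj U ** V)) gammaC"
  proof
    assume e: "compose jordan (phi x) \<alpha> = phi (q, V)"
    have "\<alpha> = phi (cnj p * q, adj U ** V)"
      by (rule Bij_eqI[OF B]) (simp add: a e phi_phi)
    then show ?thesis ..
  next
    assume e: "compose jordan (phi x) \<alpha> = compose jordan (phi (q, V)) gammaC"
    have "\<alpha> = compose jordan (phi (cnj p * q, adj U ** V)) gammaC"
      by (rule Bij_eqI[OF B(1) compose_Bij[OF B(2) gammas_Bij(3)]])
        (simp add: a e phi_phi compose_eq gammas_closed)
    then show ?thesis ..
  qed
  then show ?thesis using z by (auto simp: normal_form_def)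
qed

lemma cnj_mult_self: "cnj z * z = of_real ((cmod z)\<^sup>2)"
  by (metis complex_norm_square mult.commute)

text \<open>Equivariance makes each skew component a scalar. Products within one component show that
  the scalars are units, and the commutator ties them together by
  \<open>s\<^sub>1 = cnj (s\<^sub>2 * s\<^sub>3)\<close>. A scalar matrix \<open>U\<close> and a
  suitable \<open>p\<close> realise any such triple.\<close>

lemma normal_form_trivial_on_herm:
  assumes al: "\<alpha> \<in> centralizer" and sp: "splits \<alpha> f g\<^sub>1 g\<^sub>2 g\<^sub>3" and f: "\<And>A. A \<in> herm \<Longrightarrow> f A = A"
  shows "\<exists>x\<in>carrier (U1 \<times>\<times> U3). \<alpha> = phi x"
proof -
  note lin = splits_linear[OF al sp] and br = splits_bracket[OF al sp]
  have sk: "\<And>B. B \<in> skew \<Longrightarrow> g\<^sub>1 B \<in> skew" "\<And>B. B \<in> skew \<Longrightarrow> g\<^sub>2 B \<in> skew" "\<And>B. B \<in> skew \<Longrightarrow> g\<^sub>3 B \<in> skew"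
    using sp by (auto simp: splits_def)
  obtain s\<^sub>1 where s1: "\<And>B. B \<in> skew \<Longrightarrow> g\<^sub>1 B = smul s\<^sub>1 B"
    using equivariant_is_scalar[of g\<^sub>1] sk(1) lin(3) br(2) f by metis
  obtain s\<^sub>2 where s2: "\<And>B. B \<in> skew \<Longrightarrow> g\<^sub>2 B = smul s\<^sub>2 B"
    using equivariant_is_scalar[of g\<^sub>2] sk(2) lin(5) br(3) f by metis
  obtain s\<^sub>3 where s3: "\<And>B. B \<in> skew \<Longrightarrow> g\<^sub>3 B = smul s\<^sub>3 B"
    using equivariant_is_scalar[of g\<^sub>3] sk(3) lin(7) br(4) f by metis
  have unit: "cmod s = 1" if "kmat 1 0 0 ** cj (kmat 1 0 0) + kmat 1 0 0 ** cj (kmat 1 0 0) =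
     smul s (kmat 1 0 0) ** cj (smul s (kmat 1 0 0)) + smul s (kmat 1 0 0) ** cj (smul s (kmat 1 0 0))" for s
  proof -
    have "- (hmat 0 1 1 0 0 0 + hmat 0 1 1 0 0 0) =
      - (hmat 0 ((cmod s)\<^sup>2) ((cmod s)\<^sup>2) 0 0 0 + hmat 0 ((cmod s)\<^sup>2) ((cmod s)\<^sup>2) 0 0 0)"
      using that by (simp only: smul_kmat mult_1_right mult_zero_right kmat_square minus_add_distrib
          norm_one power_one)
    then have "(cmod s)\<^sup>2 = 1"
      unfolding neg_equal_iff_equal hmat_add by simp
    then show ?thesis using norm_ge_zero[of s] by (auto simp: power2_eq_1_iff)
  qed
  have u1: "cmod s\<^sub>1 = 1"
    by (rule unit) (use br(5)[of "kmat 1 0 0" "kmat 1 0 0"] in \<open>simp only: kmat_skew s1 f bracket_closed\<close>)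
  have u2: "cmod s\<^sub>2 = 1"
    by (rule unit) (use br(6)[of "kmat 1 0 0" "kmat 1 0 0"] in \<open>simp only: kmat_skew s2 f bracket_closed\<close>)
  have u3: "cmod s\<^sub>3 = 1"
    by (rule unit) (use br(7)[of "kmat 1 0 0" "kmat 1 0 0"] in \<open>simp only: kmat_skew s3 f bracket_closed\<close>)
  have "s\<^sub>1 = cnj (s\<^sub>2 * s\<^sub>3)"
    using br(8)[of "kmat 1 0 0" "kmat 0 1 0"]
    by (simp add: s1 s2 s3 skew_closed kmat_commutator smul_kmat cj_kmat del: cj_diff cj_mult)
  then have "cnj s\<^sub>2 * cnj s\<^sub>1 = s\<^sub>3 * (cnj s\<^sub>2 * s\<^sub>2)"
    by simp
  then have prod: "cnj s\<^sub>2 * cnj s\<^sub>1 = s\<^sub>3"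
    using u2 by (simp add: cnj_mult_self)
  \<comment> \<open>The matrix \<open>smul l (mat 1)\<close> fixes Hermitian matrices and multiplies
    skew ones by the square of \<open>l\<close>, so a square root absorbs
    \<open>s\<^sub>1\<close>.\<close>
  define l where "l = csqrt s\<^sub>1"
  have l: "l\<^sup>2 = s\<^sub>1" by (simp add: l_def)
  have nl: "cmod l = 1" using u1 by (simp add: l_def)
  have ll: "cnj l * l = 1" using nl by (simp add: cnj_mult_self)
  \<comment> \<open>Solves \<open>p * cnj (l ^ 3) * l\<^sup>2 = s\<^sub>2\<close>, whose left side
    is \<open>p * cnj l\<close> for a unit \<open>l\<close>.\<close>
  define p where "p = l * s\<^sub>2"
  have np: "cnj p * p = 1"
    unfolding cnj_mult_self using nl u2 by (simp add: p_def norm_mult)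
  have U: "smul l (mat 1) \<in> carrier U3"
    using ll by (simp add: U3_iff matrix_mult_linear mult.commute)
  have d: "det (smul l (mat 1)) = l ^ 3" by (simp add: det_smul)
  have pd: "p * cnj (det (smul l (mat 1))) * l\<^sup>2 = s\<^sub>2"
  proof -
    have "p * cnj (l ^ 3) * l\<^sup>2 = s\<^sub>2 * (cnj l * l) ^ 3"
      by (simp add: p_def power2_eq_square power3_eq_cube)
    then show ?thesis by (simp add: d ll)
  qed
  have pd': "cnj p * cnj (det (smul l (mat 1))) * l\<^sup>2 = s\<^sub>3"
  proof -
    have "cnj p * cnj (l ^ 3) * l\<^sup>2 = cnj s\<^sub>2 * cnj (l\<^sup>2) * (cnj l * l)\<^sup>2"
      by (simp add: p_def power2_eq_square power3_eq_cube)
    then show ?thesis by (simp only: d ll l prod) simp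
  qed
  have x: "(p, smul l (mat 1)) \<in> carrier (U1 \<times>\<times> U3)"
    using np U by (simp add: U1U3_iff)
  have "\<alpha> = phi (p, smul l (mat 1))"
  proof (rule Bij_eqI[OF centralizer_Bij[OF al] centralizer_Bij[OF phi_in_centralizer[OF x]]])
    fix X assume "X \<in> jordan"
    then obtain A B C D where X: "X = oct A B C D" and m: "A \<in> herm" "B \<in> skew" "C \<in> skew" "D \<in> skew"
      by (rule jordan_cases)
    have "\<alpha> X = oct A (smul s\<^sub>1 B) (smul s\<^sub>2 C) (smul s\<^sub>3 D)"
      using sp m by (simp add: X splits_def f s1 s2 s3)
    also have "\<dots> = phi (p, smul l (mat 1)) X"
      using ll pd pd' by (simp add: X phi_def twist_oct m matrix_mult_linear l[symmetric] power2_eq_square mult_ac)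
    finally show "\<alpha> X = phi (p, smul l (mat 1)) X" .
  qed
  with x show ?thesis by blast
qed

section \<open>Reduction to the identity or the conjugation on Hermitian matrices\<close>

definition diag :: "complex \<Rightarrow> complex \<Rightarrow> complex \<Rightarrow> complex^3^3" where
  "diag a b c = vector [vector [a, 0, 0], vector [0, b, 0], vector [0, 0, c]]"

lemma diag_nth: "diag a b c $ 1 = vector [a, 0, 0]" "diag a b c $ 2 = vector [0, b, 0]"
    "diag a b c $ 3 = vector [0, 0, c]"
  by (simp_all add: diag_def)

lemma diag_U3: "cnj a * a = 1 \<Longrightarrow> cnj b * b = 1 \<Longrightarrow> cnj c * c = 1 \<Longrightarrow> diag a b c \<in> carrier U3"
  by (simp add: U3_iff vec_eq_iff forall_3 diag_nth transpose_def matrix_matrix_mult_def sum_3 mat_def)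

lemma diag_congruence:
  assumes "cnj a * a = 1" "cnj b * b = 1" "cnj c * c = 1"
  shows "diag a b c ** hmat p q r x y z ** adj (diag a b c) = hmat p q r (b * x * cnj c) (a * y * cnj c) (a * z * cnj b)"
  using assms
  by (simp add: vec_eq_iff forall_3 diag_nth hmat_nth transpose_def matrix_matrix_mult_def sum_3 mult_ac)

lemma splits_compose_phi:
  assumes x: "(1, U) \<in> carrier (U1 \<times>\<times> U3)" and al: "\<alpha> \<in> centralizer" and sp: "splits \<alpha> f g\<^sub>1 g\<^sub>2 g\<^sub>3"
  shows "splits (compose jordan (phi (1, U)) \<alpha>) (\<lambda>A. U ** f A ** adj U) (\<lambda>B. U ** g\<^sub>1 B ** transpose U)
    (\<lambda>B. smul (cnj (det U)) (U ** g\<^sub>2 B ** transpose U)) (\<lambda>B. smul (cnj (det U)) (U ** g\<^sub>3 B ** transpose U))"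
  using sp by (auto simp: splits_def compose_eq oct_in_jordan_iff phi_def twist_oct herm_congruence
      skew_congruence skew_closed)

lemma normal_form_fixing_frame:
  assumes al: "\<alpha> \<in> centralizer" and sp: "splits \<alpha> f g\<^sub>1 g\<^sub>2 g\<^sub>3" and fi: "\<And>k. f (idem k) = idem k"
  shows "normal_form \<alpha>"
proof -
  note lin = splits_linear[OF al sp] and br = splits_bracket[OF al sp]
  have fh: "\<And>A. A \<in> herm \<Longrightarrow> f A \<in> herm" using sp by (auto simp: splits_def)
  obtain p q r where f: "\<forall>a b c x y z. f (hmat a b c x y z) = hmat a b c (p x) (q y) (r z)"
    and n: "\<forall>x. cmod (p x) = cmod x" "\<forall>x. cmod (r x) = cmod x"
    and m: "\<forall>x y. q (x * y) = r x * p y" "\<forall>x y. r (x * cnj y) = q x * cnj (p y)"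
    and l: "\<forall>x y. p (x + y) = p x + p y" "\<forall>c x. p (c *\<^sub>R x) = c *\<^sub>R p x"
    by (rule automorphism_fixing_frame[of f, OF fh lin(1) lin(2) br(1) fi])
  have u: "cnj (p 1) * p 1 = 1" "cnj (r 1) * r 1 = 1"
    by (simp_all only: cnj_mult_self n norm_one power_one of_real_1)
  \<comment> \<open>Normalised to send 1 to 1. The relations among \<open>p\<close>,
    \<open>q\<close>, \<open>r\<close> show that all three equal \<open>h\<close> up to constant
    phases and that \<open>h\<close> is multiplicative.\<close>
  define h where "h x = cnj (p 1) * p x" for x
  have h1: "h 1 = 1" using u by (simp add: h_def)
  have px: "p x = p 1 * h x" for x
    using u by (simp add: h_def flip: mult.assoc) (simp add: mult.commute)
  have qx: "q x = r 1 * p 1 * h x" for x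
    using m(1)[rule_format, of 1 x] by (simp add: px[of x] mult_ac)
  have rx: "r x = r 1 * h x" for x
  proof -
    have "r x = q x * cnj (p 1)" using m(2)[rule_format, of x 1] by simp
    also have "\<dots> = r 1 * h x * (cnj (p 1) * p 1)" by (simp add: qx)
    finally show ?thesis by (simp add: u)
  qed
  have hm: "h (x * y) = h x * h y" for x y
  proof -
    have "r 1 * p 1 * h (x * y) = r 1 * p 1 * (h x * h y)"
      using m(1)[rule_format, of x y] unfolding qx rx[of x] px[of y] by (simp add: mult_ac)
    moreover have "r 1 * p 1 \<noteq> 0" using u by auto
    ultimately show ?thesis by simp
  qed
  have hc: "h = id \<or> h = cnj"
    by (rule real_algebra_endomorphism_complex) (simp_all add: hm h1, simp_all add: h_def l algebra_simps)
  \<comment> \<open>Congruence by this diagonal matrix strips the phases \<open>p 1\<close>,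
    \<open>r 1 * p 1\<close> and \<open>r 1\<close> from the off-diagonal entries and leaves
    \<open>h\<close> in each.\<close>
  define W where "W = diag (cnj (r 1)) 1 (p 1)"
  have W: "(1, W) \<in> carrier (U1 \<times>\<times> U3)"
    using u by (simp add: U1U3_iff W_def diag_U3 mult.commute)
  define \<beta> where "\<beta> = compose jordan (phi (1, W)) \<alpha>"
  have be: "\<beta> \<in> centralizer"
    unfolding \<beta>_def by (rule centralizer_compose[OF phi_in_centralizer[OF W] al])
  have sb: "splits \<beta> (\<lambda>A. W ** f A ** adj W) (\<lambda>B. W ** g\<^sub>1 B ** transpose W)
    (\<lambda>B. smul (cnj (det W)) (W ** g\<^sub>2 B ** transpose W)) (\<lambda>B. smul (cnj (det W)) (W ** g\<^sub>3 B ** transpose W))"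
    unfolding \<beta>_def by (rule splits_compose_phi[OF W al sp])
  have F: "W ** f (hmat a b c x y z) ** adj W = hmat a b c (h x) (h y) (h z)" for a b c x y z
  proof -
    have "p x * cnj (p 1) = h x" by (simp add: h_def mult.commute)
    moreover have "cnj (r 1) * q y * cnj (p 1) = h y"
    proof -
      have "cnj (r 1) * q y * cnj (p 1) = (cnj (r 1) * r 1) * (cnj (p 1) * p 1) * h y"
        unfolding qx[of y] by (simp only: mult_ac)
      then show ?thesis by (simp only: u mult_1)
    qed
    moreover have "cnj (r 1) * r z = h z"
      unfolding rx[of z] by (simp only: u mult_1 flip: mult.assoc)
    ultimately show ?thesis
      unfolding f[rule_format] W_def using u by (subst diag_congruence) (simp_all add: mult.commute)
  qed
  from hc have "normal_form \<beta>"
  proof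
    assume "h = id"
    then have "W ** f A ** adj W = A" if "A \<in> herm" for A
      using herm_cases[OF that] F by (metis id_apply)
    from normal_form_trivial_on_herm[OF be sb this] show ?thesis
      by (auto simp: normal_form_def)
  next
    assume hcnj: "h = cnj"
    have F': "W ** f A ** adj W = cj A" if "A \<in> herm" for A
      using herm_cases[OF that] F hcnj by (metis cj_hmat)
    \<comment> \<open>Composing with \<open>gammaC\<close> undoes the conjugation, so the case of
      trivial action on Hermitian matrices applies.\<close>
    define \<delta> where "\<delta> = compose jordan gammaC \<beta>"
    have de: "\<delta> \<in> centralizer"
      unfolding \<delta>_def by (rule centralizer_compose[OF gammaC_in_centralizer be])
    have sd: "splits \<delta> (\<lambda>A. cj (W ** f A ** adj W)) (\<lambda>B. cj (W ** g\<^sub>1 B ** transpose W))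
      (\<lambda>B. cj (smul (cnj (det W)) (W ** g\<^sub>2 B ** transpose W))) (\<lambda>B. cj (smul (cnj (det W)) (W ** g\<^sub>3 B ** transpose W)))"
      using sb unfolding splits_def \<delta>_def
      by (simp add: compose_eq oct_in_jordan_iff gamma_oct herm_closed skew_closed
          del: cj_mult cj_smul)
    obtain t V where tV: "(t, V) \<in> carrier (U1 \<times>\<times> U3)" "\<delta> = phi (t, V)"
      using normal_form_trivial_on_herm[OF de sd] F' by fastforce
    \<comment> \<open>Moving \<open>gammaC\<close> to the right of \<open>phi (t, V)\<close>
      conjugates both parameters.\<close>
    have y: "(cnj t, cj V) \<in> carrier (U1 \<times>\<times> U3)"
      using tV(1) by (simp add: U1U3_iff U3_closed mult.commute)
    have "\<beta> = compose jordan (phi (cnj t, cj V)) gammaC"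
    proof (rule Bij_eqI[OF centralizer_Bij[OF be]
          compose_Bij[OF centralizer_Bij[OF phi_in_centralizer[OF y]] gammas_Bij(3)]])
      fix X assume X: "X \<in> jordan"
      have "gammaC (\<beta> X) = phi (t, V) X"
        using X fun_cong[OF tV(2), of X] by (simp add: \<delta>_def compose_eq)
      then have "\<beta> X = gammaC (phi (t, V) X)"
        using X be by (metis centralizer_mem gammas_involutive(3))
      then show "\<beta> X = compose jordan (phi (cnj t, cj V)) gammaC X"
        using X by (simp add: compose_eq gammaC_phi)
    qed
    then show ?thesis using y by (auto simp: normal_form_def)
  qed
  then show ?thesis
    unfolding \<beta>_def by (rule normal_form_phi_cancel[OF W al])
qed

lemma idem_nonzero: "idem k \<noteq> 0"
  by (auto simp: idem_def vec_eq_iff)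

text \<open>The symmetrised product already shows that the images of the diagonal idempotents are
  mutually orthogonal nonzero projections. The unitary matrix diagonalizing them reduces the claim
  to a fixed frame.\<close>

lemma centralizer_normal_form:
  assumes al: "\<alpha> \<in> centralizer"
  shows "normal_form \<alpha>"
proof -
  obtain f g\<^sub>1 g\<^sub>2 g\<^sub>3 where sp: "splits \<alpha> f g\<^sub>1 g\<^sub>2 g\<^sub>3"
    using centralizer_splits[OF al] .
  note lin = splits_linear[OF al sp] and br = splits_bracket[OF al sp]
  have fh: "f (idem k) \<in> herm" for k using sp idem_herm by (auto simp: splits_def)
  have pr: "f (idem k) ** f (idem k) = f (idem k)" for k
  proof -
    have "2 *\<^sub>R f (idem k) = f (2 *\<^sub>R idem k)" by (simp add: lin idem_herm)
    also have "\<dots> = f (idem k ** idem k + idem k ** idem k)"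
      by (simp add: idem_mult scaleR_2)
    also have "\<dots> = 2 *\<^sub>R (f (idem k) ** f (idem k))"
      by (simp only: br(1)[OF idem_herm idem_herm] scaleR_2)
    finally show ?thesis by simp
  qed
  have orth: "f (idem k) ** f (idem l) = 0" if "k \<noteq> l" for k l
    by (rule projections_orthogonal[OF pr])
      (use br(1)[OF idem_herm idem_herm, of k l] that in \<open>simp add: idem_mult lin(9)\<close>)
  have nz: "f (idem k) \<noteq> 0" for k
    using lin(13)[OF idem_herm] idem_nonzero by blast
  obtain U where U: "U \<in> carrier U3" and e: "\<And>k. f (idem k) = U ** idem k ** adj U"
    using orthogonal_projections_diagonalize[of "\<lambda>k. f (idem k)"] fh pr orth nz by metis
  have V: "(1, adj U) \<in> carrier (U1 \<times>\<times> U3)"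
    using U by (simp add: U1U3_iff U3_closed)
  have "adj U ** f (idem k) ** adj (adj U) = idem k" for k
    by (simp add: e matrix_mul_assoc[symmetric] U3_cancel[OF U] cj_transpose)
  then have "normal_form (compose jordan (phi (1, adj U)) \<alpha>)"
    by (intro normal_form_fixing_frame[OF centralizer_compose[OF phi_in_centralizer[OF V] al]
          splits_compose_phi[OF V al sp]])
  then show ?thesis
    by (rule normal_form_phi_cancel[OF V al])
qed

section \<open>The isomorphism\<close>

lemma phi_trivial_on_components:
  assumes "\<forall>X\<in>jordan. phi (p, U) X = X"
  shows "A \<in> herm \<Longrightarrow> U ** A ** adj U = A" "B \<in> skew \<Longrightarrow> U ** B ** transpose U = B"
    "B \<in> skew \<Longrightarrow> smul (p * cnj (det U)) (U ** B ** transpose U) = B"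
proof -
  show "A \<in> herm \<Longrightarrow> U ** A ** adj U = A"
    using bspec[OF assms, of "oct A 0 0 0"] by (simp add: phi_def twist_oct oct_in_jordan_iff skew_closed)
  show "B \<in> skew \<Longrightarrow> U ** B ** transpose U = B"
    using bspec[OF assms, of "oct 0 B 0 0"] by (simp add: phi_def twist_oct oct_in_jordan_iff skew_closed herm_closed)
  show "B \<in> skew \<Longrightarrow> smul (p * cnj (det U)) (U ** B ** transpose U) = B"
    using bspec[OF assms, of "oct 0 0 B 0"] by (simp add: phi_def twist_oct oct_in_jordan_iff skew_closed herm_closed)
qed

text \<open>At position \<open>(i, j)\<close>, multiplying by \<open>idem j\<close> on the right
  keeps the entry of \<open>U\<close>, while multiplying on the left kills it.\<close>

lemma commutes_with_frame:
  assumes "\<And>k. U ** idem k = idem k ** U" "i \<noteq> j"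
  shows "U $ i $ j = 0"
proof -
  have "(U ** idem j) $ i $ j = (idem j ** U) $ i $ j" by (simp add: assms)
  then show ?thesis
    using assms(2) by (simp add: matrix_matrix_mult_def idem_def if_distrib if_distribR sum.If_cases)
qed

text \<open>Trivial action on Hermitian matrices puts \<open>U\<close> in their commutant, so
  \<open>U\<close> is a scalar \<open>u\<close>. The first skew component gives
  \<open>u * u = 1\<close> and the second gives \<open>p = u\<close>.\<close>

lemma phi_eq_id_iff:
  assumes x: "(p, U) \<in> carrier (U1 \<times>\<times> U3)"
  shows "(\<forall>X\<in>jordan. phi (p, U) X = X) \<longleftrightarrow> (p, U) = (1, mat 1) \<or> (p, U) = (- 1, - mat 1)"
proof -
  have m: "- mat 1 = smul (- 1) (mat 1 :: complex^3^3)" by (simp add: smul_def vec_eq_iff)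
  show ?thesis
proof
  assume "\<forall>X\<in>jordan. phi (p, U) X = X"
  note t = phi_trivial_on_components[OF this]
  have U: "U \<in> carrier U3" using x by (simp add: U1U3_iff)
  have c: "U ** A = A ** U" if "A \<in> herm" for A
    using t(1)[OF that] by (metis U3_cancel(1)[OF U] matrix_mul_assoc matrix_mul_rid)
  have z: "U $ i $ j = 0" if "i \<noteq> j" for i j
    by (rule commutes_with_frame[OF c[OF idem_herm] that])
  \<comment> \<open>Commuting with a matrix whose off-diagonal entries are all 1 equates the
    diagonal entries of \<open>U\<close>.\<close>
  have "(U ** hmat 0 0 0 1 1 1) $ i $ j = (hmat 0 0 0 1 1 1 ** U) $ i $ j" for i j
    by (simp only: c hmat_herm)
  from this[of 1 2] this[of 2 3] have "U $ 1 $ 1 = U $ 2 $ 2" "U $ 2 $ 2 = U $ 3 $ 3"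
    by (simp_all add: matrix_matrix_mult_def sum_3 hmat_nth z)
  then obtain u where Uu: "U = smul u (mat 1)"
    by (intro that[of "U $ 1 $ 1"]) (simp add: vec_eq_iff forall_3 smul_def mat_def z)
  have "u * u = 1"
    using t(2)[of "kmat 1 0 0"] by (simp add: Uu matrix_mult_linear smul_kmat)
  then have u: "u = 1 \<or> u = - 1" by (simp add: square_eq_1_iff)
  have "p * cnj (u ^ 3) * (u * u) = 1"
    using t(3)[of "kmat 1 0 0"] by (simp add: Uu matrix_mult_linear smul_kmat det_smul)
  then have "p = u"
    using u by (auto simp: power3_eq_cube minus_equation_iff[of p])
  then show "(p, U) = (1, mat 1) \<or> (p, U) = (- 1, - mat 1)"
    using u by (auto simp: Uu m)
next
  assume "(p, U) = (1, mat 1) \<or> (p, U) = (- 1, - mat 1)"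
  moreover have "phi (- 1, smul (- 1) (mat 1)) X = X" if "X \<in> jordan" for X
    using that by (auto elim!: jordan_cases simp: phi_def twist_oct matrix_mult_linear det_smul)
  ultimately show "\<forall>X\<in>jordan. phi (p, U) X = X"
    by (auto simp: phi_one m)
qed
qed

text \<open>Equality would give \<open>U ** A = cj A ** U\<close> for Hermitian \<open>A\<close>.
  The real idempotents make \<open>U\<close> diagonal, and the (1,2) entries 1 and \<i> force its
  first two diagonal entries to be both equal and opposite, against unitarity.\<close>

lemma gammaC_neq_phi:
  assumes "x \<in> carrier (U1 \<times>\<times> U3)"
  shows "gammaC \<noteq> phi x"
proof
  assume e: "gammaC = phi x"
  obtain p U where x: "x = (p, U)" "U \<in> carrier U3"
    using assms U1U3_iff by (cases x) blast
  have c: "U ** A = cj A ** U" if "A \<in> herm" for A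
  proof -
    have "U ** A ** adj U = cj A"
      using fun_cong[OF e, of "oct A 0 0 0"] that
      by (simp add: x phi_def twist_oct gamma_oct skew_closed)
    then show ?thesis by (metis U3_cancel(1)[OF x(2)] matrix_mul_assoc matrix_mul_rid)
  qed
  have "cj (idem k) = idem k" for k by (simp add: vec_eq_iff idem_def)
  then have z: "U $ i $ j = 0" if "i \<noteq> j" for i j
    using commutes_with_frame[OF _ that] c[OF idem_herm] by metis
  have "(U ** hmat 0 0 0 0 0 w) $ 1 $ 2 = (cj (hmat 0 0 0 0 0 w) ** U) $ 1 $ 2" for w
    by (simp only: c hmat_herm)
  then have "U $ 1 $ 1 * w = cnj w * U $ 2 $ 2" for w
    by (simp add: matrix_matrix_mult_def sum_3 hmat_nth)
  from this[of 1] this[of \<i>] have "U $ 1 $ 1 = U $ 2 $ 2" "\<i> * (U $ 1 $ 1 + U $ 2 $ 2) = 0"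
    by (simp_all add: algebra_simps)
  then have "U $ 1 $ 1 = 0" by simp
  moreover have "(adj U ** U) $ 1 $ 1 = 1" by (simp add: U3_cancel(1)[OF x(2)] mat_def)
  ultimately show False by (simp add: matrix_matrix_mult_def sum_3 transpose_def z)
qed

section \<open>The induced homomorphism on the quotient\<close>

lemma group_U1: "group U1"
  by (rule groupI) (auto simp: U1_def mult_ac intro!: exI[of _ "cnj _"])

lemma group_U3: "group U3"
proof (rule groupI)
  show "x \<otimes>\<^bsub>U3\<^esub> y \<in> carrier U3" if "x \<in> carrier U3" "y \<in> carrier U3" for x y
    using U3_closed(2)[OF that] by (simp add: U3_def)
  show "\<exists>y\<in>carrier U3. y \<otimes>\<^bsub>U3\<^esub> x = \<one>\<^bsub>U3\<^esub>" if "x \<in> carrier U3" for x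
    using U3_closed(3)[OF that] U3_cancel(1)[OF that] by (intro bexI[of _ "adj x"]) (simp_all add: U3_def)
  show "\<one>\<^bsub>U3\<^esub> \<in> carrier U3" by (simp add: U3_def)
qed (simp_all add: U3_def matrix_mul_assoc)

lemma Bij_mult:
  assumes "\<alpha> \<in> Bij jordan" "\<beta> \<in> Bij jordan"
  shows "\<alpha> \<otimes>\<^bsub>BijGroup jordan\<^esub> \<beta> = compose jordan \<alpha> \<beta>"
  using assms by (simp add: BijGroup_def)

lemma phi_Bij: "x \<in> carrier (U1 \<times>\<times> U3) \<Longrightarrow> phi x \<in> Bij jordan"
  by (intro centralizer_Bij phi_in_centralizer)

lemma U1U3_mult [simp]: "p \<otimes>\<^bsub>U1\<^esub> q = p * q" "U \<otimes>\<^bsub>U3\<^esub> V = U ** V"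
  by (simp_all add: U1_def U3_def)

text \<open>The target is the full group of bijections, whose multiplication and unit
  \<open>F4\<close> shares.\<close>

lemma group_hom_phi: "group_hom (U1 \<times>\<times> U3) (BijGroup jordan) phi"
proof -
  interpret G: group "U1 \<times>\<times> U3" by (rule DirProd_group[OF group_U1 group_U3])
  have "phi (x \<otimes>\<^bsub>U1 \<times>\<times> U3\<^esub> y) = phi x \<otimes>\<^bsub>BijGroup jordan\<^esub> phi y"
    if h: "x \<in> carrier (U1 \<times>\<times> U3)" "y \<in> carrier (U1 \<times>\<times> U3)" for x y
  proof -
    obtain p U q V where xy: "x = (p, U)" "y = (q, V)" by (cases x, cases y) blast
    show ?thesis
      unfolding Bij_mult[OF phi_Bij[OF h(1)] phi_Bij[OF h(2)]]
      by (rule Bij_eqI[OF phi_Bij[OF G.m_closed[OF h]] compose_Bij[OF phi_Bij[OF h(1)] phi_Bij[OF h(2)]]])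
        (simp add: xy compose_eq phi_phi)
  qed
  then have "phi \<in> hom (U1 \<times>\<times> U3) (BijGroup jordan)"
    by (intro homI) (simp_all add: phi_Bij, simp add: BijGroup_def phi_Bij)
  then show ?thesis
    by (simp add: group_hom_def group_hom_axioms_def group_BijGroup G.group_axioms)
qed

lemma kernel_phi: "kernel (U1 \<times>\<times> U3) (BijGroup jordan) phi = {(1, mat 1), (- 1, - mat 1)}"
proof (rule Set.set_eqI)
  fix x :: "complex \<times> (complex^3^3)"
  obtain p U where x: "x = (p, U)" by (cases x)
  have m: "(1, mat 1) \<in> carrier (U1 \<times>\<times> U3)" "(- 1, - mat 1) \<in> carrier (U1 \<times>\<times> U3)"
    by (simp_all add: U1U3_iff U3_iff matrix_mult_linear)
  have "phi (p, U) = \<one>\<^bsub>BijGroup jordan\<^esub> \<longleftrightarrow> (\<forall>X\<in>jordan. phi (p, U) X = X)" if "(p, U) \<in> carrier (U1 \<times>\<times> U3)"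
    using Bij_eqI[OF phi_Bij[OF that] id_Bij] by (auto simp: BijGroup_def)
  then show "x \<in> kernel (U1 \<times>\<times> U3) (BijGroup jordan) phi \<longleftrightarrow> x \<in> {(1, mat 1), (- 1, - mat 1)}"
    using phi_eq_id_iff[of p U] m unfolding kernel_def x mem_Collect_eq insert_iff empty_iff by metis
qed

declare carrier_DirProd [simp del]

lemma carrier_BijGroup: "carrier (BijGroup S) = Bij S"
  by (simp add: BijGroup_def)

lemma F4_eq_BijGroup [simp]: "mult F4 = mult (BijGroup jordan)" "one F4 = one (BijGroup jordan)"
  by (simp_all add: F4_def)

text \<open>The explicit map runs from the semidirect product to the automorphisms, opposite to the
  claim. Closure of \<open>G\<close> lets its inverse inherit multiplicativity.\<close>

lemma hom_bij_imp_is_iso: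
  assumes h: "h \<in> hom G H" and b: "bij_betw h (carrier G) (carrier H)"
    and cl: "\<And>x y. x \<in> carrier G \<Longrightarrow> y \<in> carrier G \<Longrightarrow> x \<otimes>\<^bsub>G\<^esub> y \<in> carrier G"
  shows "H \<cong> G"
proof -
  have b': "bij_betw (inv_into (carrier G) h) (carrier H) (carrier G)"
    by (rule bij_betw_inv_into[OF b])
  have "inv_into (carrier G) h (u \<otimes>\<^bsub>H\<^esub> v) = inv_into (carrier G) h u \<otimes>\<^bsub>G\<^esub> inv_into (carrier G) h v"
    if uv: "u \<in> carrier H" "v \<in> carrier H" for u v
  proof -
    have m: "inv_into (carrier G) h u \<in> carrier G" "inv_into (carrier G) h v \<in> carrier G"
      using b' uv by (auto simp: bij_betw_def)
    have "h (inv_into (carrier G) h u \<otimes>\<^bsub>G\<^esub> inv_into (carrier G) h v) = u \<otimes>\<^bsub>H\<^esub> v"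
      using b uv by (simp add: hom_mult[OF h m] bij_betw_inv_into_right)
    then show ?thesis
      using bij_betw_inv_into_left[OF b cl[OF m]] by simp
  qed
  then have "inv_into (carrier G) h \<in> iso H G"
    using b' by (auto simp: iso_def hom_def bij_betw_def)
  then show ?thesis by (rule is_isoI)
qed

abbreviation N2 :: "(complex \<times> (complex^3^3)) set" where
  "N2 \<equiv> {(1, mat 1), (- 1, - mat 1)}"

definition sgn_class :: "complex \<times> (complex^3^3) \<Rightarrow> (complex \<times> (complex^3^3)) set" where
  "sgn_class x = N2 #>\<^bsub>U1 \<times>\<times> U3\<^esub> x"

text \<open>The image of a coset is a singleton because \<open>phi\<close> is constant on cosets of
  its kernel.\<close>

definition phi_quot :: "(complex \<times> (complex^3^3)) set \<Rightarrow> cayley^3^3 \<Rightarrow> cayley^3^3" where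
  "phi_quot c = the_elem (phi ` c)"

interpretation phi: group_hom "U1 \<times>\<times> U3" "BijGroup jordan" phi
  by (rule group_hom_phi)

lemma sgn_class_explicit: "sgn_class (p, U) = {(p, U), (- p, - U)}"
  by (auto simp: sgn_class_def r_coset_def matrix_mult_linear)

lemma phi_uminus:
  assumes "(p, U) \<in> carrier (U1 \<times>\<times> U3)"
  shows "phi (- p, - U) = phi (p, U)"
proof -
  have m: "(- 1, - mat 1) \<in> kernel (U1 \<times>\<times> U3) (BijGroup jordan) phi"
    unfolding kernel_phi by simp
  then have "phi ((- 1, - mat 1) \<otimes>\<^bsub>U1 \<times>\<times> U3\<^esub> (p, U)) = phi (p, U)"
    using phi.hom_mult[OF _ assms, of "(- 1, - mat 1)"] phi.hom_closed[OF assms]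
    by (simp add: kernel_def phi.H.l_one)
  then show ?thesis by (simp add: matrix_mult_linear)
qed

lemma phi_quot_class:
  assumes "x \<in> carrier (U1 \<times>\<times> U3)"
  shows "phi_quot (sgn_class x) = phi x"
proof -
  obtain p U where x: "x = (p, U)" by (cases x)
  show ?thesis
    using assms by (simp add: phi_quot_def x sgn_class_explicit phi_uminus)
qed

lemma carrier_quot: "carrier U1U3_quot = sgn_class ` carrier (U1 \<times>\<times> U3)"
  unfolding U1U3_quot_def sgn_class_def by (rule carrier_FactGroup)

lemma mult_quot:
  assumes "x \<in> carrier (U1 \<times>\<times> U3)" "y \<in> carrier (U1 \<times>\<times> U3)"
  shows "sgn_class x \<otimes>\<^bsub>U1U3_quot\<^esub> sgn_class y = sgn_class (x \<otimes>\<^bsub>U1 \<times>\<times> U3\<^esub> y)"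
  using normal.rcos_sum[OF phi.normal_kernel assms] by (simp add: U1U3_quot_def sgn_class_def kernel_phi)

text \<open>This is the injectivity half of the first isomorphism theorem for
  \<open>phi\<close>.\<close>

lemma sgn_class_eqI:
  assumes "x \<in> carrier (U1 \<times>\<times> U3)" "y \<in> carrier (U1 \<times>\<times> U3)" "phi x = phi y"
  shows "sgn_class x = sgn_class y"
  using inj_onD[OF phi.FactGroup_inj_on, of "sgn_class x" "sgn_class y"] assms
  by (simp add: carrier_FactGroup kernel_phi phi_quot_class[unfolded phi_quot_def] flip: sgn_class_def)

definition conj_pair :: "complex \<times> (complex^3^3) \<Rightarrow> complex \<times> (complex^3^3)" where
  "conj_pair = map_prod cnj cj"

lemma conj_pair_carrier:
  assumes "x \<in> carrier (U1 \<times>\<times> U3)"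
  shows "conj_pair x \<in> carrier (U1 \<times>\<times> U3)"
  using assms by (cases x) (auto simp: conj_pair_def U1U3_iff U3_closed mult.commute)

lemma conj_pair_class: "conj_pair ` sgn_class x = sgn_class (conj_pair x)"
  by (cases x) (simp add: sgn_class_explicit conj_pair_def)

lemma gammaC_neq_one: "gammaC \<noteq> \<one>\<^bsub>BijGroup jordan\<^esub>"
  using gammaC_neq_phi[OF phi.G.one_closed] by (simp only: phi.hom_one not_False_eq_True)

text \<open>The action tests against \<open>gammaC\<close>, so the second equation rests on
  \<open>gammaC\<close> not being the identity.\<close>

lemma Z2C_act_class:
  "Z2C_act_quot gammaC (sgn_class x) = sgn_class (conj_pair x)"
  "Z2C_act_quot \<one>\<^bsub>BijGroup jordan\<^esub> (sgn_class x) = sgn_class x"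
  using gammaC_neq_one conj_pair_class[of x] by (simp_all add: Z2C_act_quot_def Z2C_act_def[abs_def] conj_pair_def)

lemma gammaC_phi_mult:
  assumes "x \<in> carrier (U1 \<times>\<times> U3)"
  shows "gammaC \<otimes>\<^bsub>BijGroup jordan\<^esub> phi x = phi (conj_pair x) \<otimes>\<^bsub>BijGroup jordan\<^esub> gammaC"
proof -
  obtain p U where x: "x = (p, U)" by (cases x)
  note B = gammas_Bij(3) phi_Bij[OF assms] phi_Bij[OF conj_pair_carrier[OF assms]]
  show ?thesis
    unfolding Bij_mult[OF B(1,2)] Bij_mult[OF B(3,1)]
    by (rule Bij_eqI[OF compose_Bij[OF B(1,2)] compose_Bij[OF B(3,1)]])
      (simp add: compose_eq x conj_pair_def gammaC_phi)
qed

lemma gammaC_square: "gammaC \<otimes>\<^bsub>BijGroup jordan\<^esub> gammaC = \<one>\<^bsub>BijGroup jordan\<^esub>"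
  unfolding Bij_mult[OF gammas_Bij(3,3)]
  by (rule Bij_eqI[OF compose_Bij[OF gammas_Bij(3,3)]])
    (simp_all add: BijGroup_def id_Bij compose_eq gammas_involutive)

section \<open>The map from the semidirect product to the centralizer\<close>

abbreviation (input) Q :: "((complex \<times> (complex^3^3)) set \<times> (cayley^3^3 \<Rightarrow> cayley^3^3)) monoid" where
  "Q \<equiv> semidirect U1U3_quot Z2C Z2C_act_quot"

lemma Q_cases:
  assumes "w \<in> carrier Q"
  obtains x k where "x \<in> carrier (U1 \<times>\<times> U3)" "k \<in> {\<one>\<^bsub>BijGroup jordan\<^esub>, gammaC}" "w = (sgn_class x, k)"
  using assms by (auto simp: semidirect_def Z2C_def carrier_quot)

lemma Q_memI:
  assumes "x \<in> carrier (U1 \<times>\<times> U3)" "k \<in> {\<one>\<^bsub>BijGroup jordan\<^esub>, gammaC}"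
  shows "(sgn_class x, k) \<in> carrier Q"
  using assms by (auto simp: semidirect_def Z2C_def carrier_quot)

lemma Q_mult:
  assumes "x \<in> carrier (U1 \<times>\<times> U3)" "y \<in> carrier (U1 \<times>\<times> U3)"
  shows "(sgn_class x, \<one>\<^bsub>BijGroup jordan\<^esub>) \<otimes>\<^bsub>Q\<^esub> (sgn_class y, k)
      = (sgn_class (x \<otimes>\<^bsub>U1 \<times>\<times> U3\<^esub> y), \<one>\<^bsub>BijGroup jordan\<^esub> \<otimes>\<^bsub>BijGroup jordan\<^esub> k)"
    "(sgn_class x, gammaC) \<otimes>\<^bsub>Q\<^esub> (sgn_class y, k)
      = (sgn_class (x \<otimes>\<^bsub>U1 \<times>\<times> U3\<^esub> conj_pair y), gammaC \<otimes>\<^bsub>BijGroup jordan\<^esub> k)"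
  using assms by (simp_all add: semidirect_def Z2C_act_class Z2C_def mult_quot conj_pair_carrier)

theorem theorem4p2p4:
  shows "F4\<lparr>carrier := F4_fixed gamma \<inter> F4_fixed gammaH\<rparr> \<cong>
         semidirect U1U3_quot Z2C Z2C_act_quot"
proof (rule hom_bij_imp_is_iso)
  let ?B = "BijGroup jordan"
  let ?G = "F4\<lparr>carrier := F4_fixed gamma \<inter> F4_fixed gammaH\<rparr>"
  define \<Psi> where "\<Psi> = (\<lambda>(c, k). phi_quot c \<otimes>\<^bsub>?B\<^esub> k)"
  have \<Psi>: "\<Psi> (sgn_class x, k) = phi x \<otimes>\<^bsub>?B\<^esub> k" if "x \<in> carrier (U1 \<times>\<times> U3)" for x k
    using that by (simp add: \<Psi>_def phi_quot_class)
  have gC: "gammaC \<in> carrier ?B" by (simp add: carrier_BijGroup gammas_Bij)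
  note [simp] = phi.H.m_closed phi.H.l_one phi.H.r_one phi.hom_closed
  have G: "carrier ?G = centralizer" by (simp add: centralizer_def)
  show "w \<otimes>\<^bsub>Q\<^esub> w' \<in> carrier Q" if "w \<in> carrier Q" "w' \<in> carrier Q" for w w'
    using that
  proof -
    obtain x k where w: "x \<in> carrier (U1 \<times>\<times> U3)" "k \<in> {\<one>\<^bsub>?B\<^esub>, gammaC}" "w = (sgn_class x, k)"
      using \<open>w \<in> carrier Q\<close> by (rule Q_cases)
    obtain y l where w': "y \<in> carrier (U1 \<times>\<times> U3)" "l \<in> {\<one>\<^bsub>?B\<^esub>, gammaC}" "w' = (sgn_class y, l)"
      using \<open>w' \<in> carrier Q\<close> by (rule Q_cases)
    have "k \<otimes>\<^bsub>?B\<^esub> l \<in> {\<one>\<^bsub>?B\<^esub>, gammaC}"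
      using w(2) w'(2) gC by (auto simp: gammaC_square)
    then show ?thesis
      using w w' conj_pair_carrier[OF w'(1)] by (auto simp only: Q_mult intro!: Q_memI phi.G.m_closed)
  qed
  have "\<Psi> w \<in> centralizer" if "w \<in> carrier Q" for w
    using that
  proof (rule Q_cases)
    fix x k assume x: "x \<in> carrier (U1 \<times>\<times> U3)" and k: "k \<in> {\<one>\<^bsub>?B\<^esub>, gammaC}" and w: "w = (sgn_class x, k)"
    show ?thesis
      using k centralizer_compose[OF phi_in_centralizer[OF x] gammaC_in_centralizer] phi_in_centralizer[OF x] x
      by (auto simp: w \<Psi> Bij_mult[OF phi_Bij gammas_Bij(3)])
  qed
  moreover have "\<Psi> (w \<otimes>\<^bsub>Q\<^esub> w') = \<Psi> w \<otimes>\<^bsub>?B\<^esub> \<Psi> w'" if "w \<in> carrier Q" "w' \<in> carrier Q" for w w'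
  proof -
    obtain x k where w: "x \<in> carrier (U1 \<times>\<times> U3)" "k \<in> {\<one>\<^bsub>?B\<^esub>, gammaC}" "w = (sgn_class x, k)"
      using \<open>w \<in> carrier Q\<close> by (rule Q_cases)
    obtain y l where w': "y \<in> carrier (U1 \<times>\<times> U3)" "l \<in> {\<one>\<^bsub>?B\<^esub>, gammaC}" "w' = (sgn_class y, l)"
      using \<open>w' \<in> carrier Q\<close> by (rule Q_cases)
    have l: "l \<in> carrier ?B" using w'(2) gC by auto
    note y' = conj_pair_carrier[OF w'(1)]
    have p: "phi x \<in> carrier ?B" "phi y \<in> carrier ?B" "phi (conj_pair y) \<in> carrier ?B"
      using w(1) w'(1) y' by simp_all
    from w(2) consider "k = \<one>\<^bsub>?B\<^esub>" | "k = gammaC" by blast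
    then show ?thesis
    proof cases
      case 1
      then show ?thesis
        using w w' l p by (simp add: Q_mult \<Psi> phi.G.m_closed phi.hom_mult phi.H.m_assoc)
    next
      case 2
      \<comment> \<open>The semidirect product has already conjugated \<open>y\<close>; commuting
        \<open>gammaC\<close> back past \<open>phi\<close> restores \<open>phi y\<close>.\<close>
      have "\<Psi> (w \<otimes>\<^bsub>Q\<^esub> w') = phi x \<otimes>\<^bsub>?B\<^esub> ((phi (conj_pair y) \<otimes>\<^bsub>?B\<^esub> gammaC) \<otimes>\<^bsub>?B\<^esub> l)"
        using w w' y' l p gC 2
        by (simp add: Q_mult \<Psi> phi.G.m_closed phi.hom_mult phi.H.m_assoc)
      also have "\<dots> = \<Psi> w \<otimes>\<^bsub>?B\<^esub> \<Psi> w'"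
        using w w' l p gC 2 by (simp add: \<Psi> phi.H.m_assoc flip: gammaC_phi_mult)
      finally show ?thesis .
    qed
  qed
  ultimately show "\<Psi> \<in> hom Q ?G"
    by (intro homI) (simp_all only: G monoid.update_convs, simp_all add: F4_def)
  have "inj_on \<Psi> (carrier Q)"
  proof (rule inj_onI)
    fix w w' assume "w \<in> carrier Q" "w' \<in> carrier Q" and e: "\<Psi> w = \<Psi> w'"
    obtain x k where w: "x \<in> carrier (U1 \<times>\<times> U3)" "k \<in> {\<one>\<^bsub>?B\<^esub>, gammaC}" "w = (sgn_class x, k)"
      using \<open>w \<in> carrier Q\<close> by (rule Q_cases)
    obtain y l where w': "y \<in> carrier (U1 \<times>\<times> U3)" "l \<in> {\<one>\<^bsub>?B\<^esub>, gammaC}" "w' = (sgn_class y, l)"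
      using \<open>w' \<in> carrier Q\<close> by (rule Q_cases)
    \<comment> \<open>Otherwise \<open>gammaC\<close> would itself be a value of \<open>phi\<close>.
      Hence equal images have equal second components, which then cancel.\<close>
    have no: "phi x' \<otimes>\<^bsub>?B\<^esub> gammaC \<noteq> phi y'"
      if h: "x' \<in> carrier (U1 \<times>\<times> U3)" "y' \<in> carrier (U1 \<times>\<times> U3)" for x' y'
    proof
      assume "phi x' \<otimes>\<^bsub>?B\<^esub> gammaC = phi y'"
      then have "gammaC = inv\<^bsub>?B\<^esub> (phi x') \<otimes>\<^bsub>?B\<^esub> phi y'"
        using h gC by (metis phi.H.inv_solve_left' phi.hom_closed phi.H.m_closed)
      also have "\<dots> = phi (inv\<^bsub>U1 \<times>\<times> U3\<^esub> x' \<otimes>\<^bsub>U1 \<times>\<times> U3\<^esub> y')"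
        using h by (simp add: phi.hom_mult phi.hom_inv phi.G.inv_closed)
      finally show False
        using gammaC_neq_phi h by (meson phi.G.inv_closed phi.G.m_closed)
    qed
    have e': "phi x \<otimes>\<^bsub>?B\<^esub> k = phi y \<otimes>\<^bsub>?B\<^esub> l"
      using e w w' by (simp add: \<Psi>)
    have "k = l"
      using w(2) w'(2) e' no[OF w(1) w'(1)] no[OF w'(1) w(1)] w(1) w'(1) by auto
    then have "phi x = phi y"
      using e' w w' gC by (auto simp: phi.H.right_cancel)
    then show "w = w'"
      using sgn_class_eqI[OF w(1) w'(1)] w w' \<open>k = l\<close> by simp
  qed
  moreover have "\<Psi> ` carrier Q = centralizer"
  proof
    show "\<Psi> ` carrier Q \<subseteq> centralizer" using \<open>\<And>w. w \<in> carrier Q \<Longrightarrow> \<Psi> w \<in> centralizer\<close> by blast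
    \<comment> \<open>Surjectivity is the normal form: its two alternatives are the two choices of
      the second component.\<close>
    show "centralizer \<subseteq> \<Psi> ` carrier Q"
    proof
      fix \<alpha> assume "\<alpha> \<in> centralizer"
      then obtain x where x: "x \<in> carrier (U1 \<times>\<times> U3)"
        and a: "\<alpha> = phi x \<or> \<alpha> = compose jordan (phi x) gammaC"
        using centralizer_normal_form unfolding normal_form_def by blast
      have "(sgn_class x, \<one>\<^bsub>?B\<^esub>) \<in> carrier Q" "(sgn_class x, gammaC) \<in> carrier Q"
        by (rule Q_memI[OF x]; simp)+
      moreover have "\<Psi> (sgn_class x, \<one>\<^bsub>?B\<^esub>) = phi x" "\<Psi> (sgn_class x, gammaC) = compose jordan (phi x) gammaC"
        using x by (simp_all add: \<Psi> Bij_mult[OF phi_Bij gammas_Bij(3)])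
      ultimately show "\<alpha> \<in> \<Psi> ` carrier Q" using a by (metis image_eqI)
    qed
  qed
  ultimately show "bij_betw \<Psi> (carrier Q) (carrier ?G)"
    by (simp add: bij_betw_def centralizer_def)
qed

end
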